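(* There exist absolute constants $C,C_1>0$ such that the following holds. Let $T_*\in\mathcal T(K)$ (all $K$ coordinates of $T_*$ are positive) and assume $$N\ge C\,\frac{\log K}{\kappa^4(A_{\underline J},K)\,T_{\min}^3}$$ (in particular $\kappa(A_{\underline J},K)>0$). Then $$\mathbb P\left\{\|\widehat T_{\rm mle}-T_*\|_1\le C_1\,\kappa^{-1}(A_{\overline J},K)\sqrt{\frac KN}\right\}\ge 1-2p^{-1}-4K^{-1}-2e^{-K}.$$
   Context: Setting. $p>K\ge1$ and $N\ge 1$ are integers, $\Delta_d=\{x\in\mathbb R^d: x_j\ge 0\ \forall j,\ \sum_j x_j=1\}$. $A\in\mathbb R^{p\times K}$ is a known matrix whose columns belong to $\Delta_p$; $A_{j\cdot}\in\mathbb R^K$ denotes its $j$-th row (as a column vector) and, for $U\subseteq[p]$, $A_U$ denotes the submatrix of rows in $U$. $T_*\in\Delta_K$, $\Pi_*=AT_*\in\Delta_p$, and the data $X\in\mathbb R^p$ satisfies $NX\sim\mathrm{Multinomial}_p(N;\Pi_* )$. $\mathcal T(s)=\{T\in\Delta_K:|\mathrm{supp}(T)|=s\}$ and $T_{\min}=\min_{k\in\mathrm{supp}(T_* )}T_{*k}$. Estimator. $J=\{j\in[p]:X_j>0\}$ and $\widehat T_{\rm mle}\in\arg\max_{T\in\Delta_K}\sum_{j\in J}X_j\log(A_{j\cdot}^\top T)$. Quantities. $\overline J=\{j:\Pi_{*j}>0\}$; $\varepsilon_j=2\sqrt{\Pi_{*j}\log p/N}+\frac{4\log p}{3N}$; $\underline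 J=\{j:\Pi_{*j}>2\varepsilon_j\}$. For a matrix $M$ with $K$ columns, $$\kappa(M,s)=\min_{S\subseteq[K],\,|S|\le s}\ \min_{v\in\mathcal C(S)}\frac{\|Mv\|_1}{\|v\|_1},\qquad \mathcal C(S)=\{v\in\mathbb R^K\setminus\{0\}:\|v_S\|_1\ge\|v_{S^c}\|_1\}$$ (so $\kappa(M,K)=\min_{v\neq0}\|Mv\|_1/\|v\|_1$). *)

theory Defs
  imports "HOL-Probability.Probability"
begin

text \<open>
  The dimensions \<open>p\<close> and \<open>K\<close> are quantified inside the scope of the absolute constants, so they
  cannot be types. A vector of dimension \<open>d\<close> is a function on \<open>nat\<close> that vanishes outside
  \<open>{..<d}\<close>; a \<open>p \<times> K\<close> matrix is a function \<open>A\<close> of which only the entries \<open>A j k\<close> with \<open>j < p\<close>,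
  \<open>k < K\<close> are used; the submatrix \<open>A\<^sub>U\<close> is represented by \<open>A\<close> together with its set \<open>U\<close> of rows.
\<close>

definition Rvec :: "nat \<Rightarrow> (nat \<Rightarrow> real) set" where
  "Rvec d = {x. \<forall>i\<ge>d. x i = 0}"

definition l1norm :: "nat set \<Rightarrow> (nat \<Rightarrow> real) \<Rightarrow> real" where
  "l1norm I x = (\<Sum>i\<in>I. \<bar>x i\<bar>)"

definition prob_simplex :: "nat \<Rightarrow> (nat \<Rightarrow> real) set" where
  "prob_simplex d = {x \<in> Rvec d. (\<forall>i<d. 0 \<le> x i) \<and> (\<Sum>i<d. x i) = 1}"

definition supp :: "nat \<Rightarrow> (nat \<Rightarrow> real) \<Rightarrow> nat set" where
  "supp d x = {i. i < d \<and> x i \<noteq> 0}"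

definition sparse_simplex :: "nat \<Rightarrow> nat \<Rightarrow> (nat \<Rightarrow> real) set" where
  "sparse_simplex K s = {T \<in> prob_simplex K. card (supp K T) = s}"

definition Tmin :: "nat \<Rightarrow> (nat \<Rightarrow> real) \<Rightarrow> real" where
  "Tmin K T = Min (T ` supp K T)"

definition row_prod :: "nat \<Rightarrow> (nat \<Rightarrow> nat \<Rightarrow> real) \<Rightarrow> (nat \<Rightarrow> real) \<Rightarrow> nat \<Rightarrow> real" where
  "row_prod K A v j = (\<Sum>k<K. A j k * v k)"

definition mat_vec ::
    "nat \<Rightarrow> nat \<Rightarrow> (nat \<Rightarrow> nat \<Rightarrow> real) \<Rightarrow> (nat \<Rightarrow> real) \<Rightarrow> nat \<Rightarrow> real" where
  "mat_vec p K A v = (\<lambda>j. if j < p then row_prod K A v j else 0)"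

definition columns_in_simplex :: "nat \<Rightarrow> nat \<Rightarrow> (nat \<Rightarrow> nat \<Rightarrow> real) \<Rightarrow> bool" where
  "columns_in_simplex p K A \<longleftrightarrow>
     (\<forall>k<K. (\<lambda>j. if j < p then A j k else 0) \<in> prob_simplex p)"

lemma mat_vec_in_prob_simplex:
  assumes "columns_in_simplex p K A" "T \<in> prob_simplex K"
  shows "mat_vec p K A T \<in> prob_simplex p"
proof -
  have A: "\<And>k j. k < K \<Longrightarrow> j < p \<Longrightarrow> 0 \<le> A j k" "\<And>k. k < K \<Longrightarrow> (\<Sum>j<p. A j k) = 1"
    using assms(1) by (auto simp: columns_in_simplex_def prob_simplex_def)
  have T: "\<And>k. k < K \<Longrightarrow> 0 \<le> T k" "(\<Sum>k<K. T k) = 1"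
    using assms(2) by (auto simp: prob_simplex_def)
  have "(\<Sum>j<p. \<Sum>k<K. A j k * T k) = (\<Sum>k<K. (\<Sum>j<p. A j k) * T k)"
    by (subst sum.swap) (simp add: sum_distrib_right)
  also have "\<dots> = 1" using A(2) T(2) by simp
  finally show ?thesis
    using A T by (auto simp: prob_simplex_def Rvec_def mat_vec_def row_prod_def intro!: sum_nonneg)
qed

text \<open>
  Cone and \<open>\<ell>\<^sub>1\<close>-\<open>\<ell>\<^sub>1\<close> condition number of \<open>A\<^sub>U\<close>. For \<open>K \<ge> 1\<close> and \<open>s \<ge> 1\<close> the infimum is over a
  nonempty set of nonnegative reals and is attained; if \<open>U\<close> is empty, it is \<open>0\<close>.
\<close>

definition cone :: "nat \<Rightarrow> nat set \<Rightarrow> (nat \<Rightarrow> real) set" where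
  "cone K S = {v \<in> Rvec K. v \<noteq> (\<lambda>_. 0) \<and> l1norm S v \<ge> l1norm ({..<K} - S) v}"

definition kappa :: "nat \<Rightarrow> (nat \<Rightarrow> nat \<Rightarrow> real) \<Rightarrow> nat set \<Rightarrow> nat \<Rightarrow> real" where
  "kappa K A U s =
     Inf {l1norm U (row_prod K A v) / l1norm {..<K} v | S v.
            S \<subseteq> {..<K} \<and> card S \<le> s \<and> v \<in> cone K S}"

text \<open>The index sets \<open>\<overline>J\<close> and \<open>\<underline>J\<close>, for a probability vector \<open>\<pi>\<close> in the role of \<open>\<Pi>\<^sub>*\<close>.\<close>

definition eps :: "nat \<Rightarrow> nat \<Rightarrow> (nat \<Rightarrow> real) \<Rightarrow> nat \<Rightarrow> real" where
  "eps p N \<pi> j = 2 * sqrt (\<pi> j * ln (real p) / real N) + 4 * ln (real p) / (3 * real N)"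

definition J_upper :: "nat \<Rightarrow> (nat \<Rightarrow> real) \<Rightarrow> nat set" where
  "J_upper p \<pi> = {j. j < p \<and> \<pi> j > 0}"

definition J_lower :: "nat \<Rightarrow> nat \<Rightarrow> (nat \<Rightarrow> real) \<Rightarrow> nat set" where
  "J_lower p N \<pi> = {j. j < p \<and> \<pi> j > 2 * eps p N \<pi> j}"

text \<open>
  The multinomial distribution is the law of the category counts of \<open>N\<close> independent draws from
  \<open>\<pi>\<close>. \<open>freq_pmf\<close> is the law of \<open>X\<close> when \<open>N X\<close> is multinomial.
\<close>

definition categorical_pmf :: "nat \<Rightarrow> (nat \<Rightarrow> real) \<Rightarrow> nat pmf" where
  "categorical_pmf p \<pi> = embed_pmf (\<lambda>j. if j < p then \<pi> j else 0)"

lemma pmf_categorical_pmf: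
  assumes "\<pi> \<in> prob_simplex p"
  shows "pmf (categorical_pmf p \<pi>) j = \<pi> j"
proof -
  have nonneg: "0 \<le> (if i < p then \<pi> i else 0)" for i
    using assms by (auto simp: prob_simplex_def)
  have "(\<integral>\<^sup>+i. ennreal (if i < p then \<pi> i else 0) \<partial>count_space UNIV)
      = (\<Sum>i<p. ennreal (if i < p then \<pi> i else 0))"
    by (rule nn_integral_count_space'[of "{..<p}"]) auto
  also have "\<dots> = ennreal (\<Sum>i<p. if i < p then \<pi> i else 0)"
    by (rule sum_ennreal) (rule nonneg)
  also have "(\<Sum>i<p. if i < p then \<pi> i else 0) = 1"
    using assms by (simp add: prob_simplex_def)
  finally have "pmf (categorical_pmf p \<pi>) j = (if j < p then \<pi> j else 0)"
    unfolding categorical_pmf_def by (intro pmf_embed_pmf nonneg) simp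
  then show ?thesis
    using assms by (auto simp: prob_simplex_def Rvec_def)
qed

definition multinomial_pmf :: "nat \<Rightarrow> nat \<Rightarrow> (nat \<Rightarrow> real) \<Rightarrow> (nat \<Rightarrow> nat) pmf" where
  "multinomial_pmf p N \<pi> =
     map_pmf (\<lambda>xs j. count_list xs j) (replicate_pmf N (categorical_pmf p \<pi>))"

definition freq_pmf :: "nat \<Rightarrow> nat \<Rightarrow> (nat \<Rightarrow> real) \<Rightarrow> (nat \<Rightarrow> real) pmf" where
  "freq_pmf p N \<pi> = map_pmf (\<lambda>n j. real (n j) / real N) (multinomial_pmf p N \<pi>)"

text \<open>
  The log-likelihood has values in the extended reals, with \<open>log 0 = -\<infinity>\<close>: since \<open>ln 0 = 0\<close>
  in HOL, a real-valued objective would reward parameters of likelihood zero.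
\<close>

definition ext_ln :: "real \<Rightarrow> ereal" where
  "ext_ln x = (if x > 0 then ereal (ln x) else -\<infinity>)"

definition loglik ::
    "nat \<Rightarrow> nat \<Rightarrow> (nat \<Rightarrow> nat \<Rightarrow> real) \<Rightarrow> (nat \<Rightarrow> real) \<Rightarrow> (nat \<Rightarrow> real) \<Rightarrow> ereal" where
  "loglik p K A X T = (\<Sum>j | j < p \<and> X j > 0. ereal (X j) * ext_ln (row_prod K A T j))"

definition is_mle ::
    "nat \<Rightarrow> nat \<Rightarrow> (nat \<Rightarrow> nat \<Rightarrow> real) \<Rightarrow> (nat \<Rightarrow> real) \<Rightarrow> (nat \<Rightarrow> real) \<Rightarrow> bool" where
  "is_mle p K A X T \<longleftrightarrow> is_arg_max (loglik p K A X) (\<lambda>T. T \<in> prob_simplex K) T"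

end

theory Submission
  imports Defs
begin

text \<open>
  Write \<open>\<pi> = A T\<close> for the cell probabilities and \<open>h\<^sub>v(j) = (A v)\<^sub>j / \<pi>\<^sub>j\<close> for the relative change
  of \<open>\<pi>\<^sub>j\<close> in direction \<open>v\<close>. Since all coordinates of \<open>T\<close> are positive, \<open>A v\<close> vanishes wherever \<open>\<pi>\<close>
  does, so \<open>v \<mapsto> h\<^sub>v\<close> loses nothing. Let \<open>\<parallel>h\<^sub>v\<parallel>\<close> be the norm in \<open>L\<^sup>2(\<pi>)\<close>, that is, the Fisher
  information norm of \<open>v\<close>. By Cauchy--Schwarz \<open>\<kappa> \<parallel>v\<parallel>\<^sub>1 \<le> \<parallel>A v\<parallel>\<^sub>1 \<le> \<parallel>h\<^sub>v\<parallel>\<close>, where \<open>\<kappa>\<close> is the condition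
  number over all the cells of positive probability, so it suffices to show
  \<open>\<parallel>h\<^sub>\<Delta>\<parallel> \<le> 32 \<surd>(K / N)\<close> for the error \<open>\<Delta>\<close> of the maximum likelihood estimator.

  Optimality says that the empirical mean of \<open>ln (1 + h\<^sub>\<Delta>)\<close> is nonnegative. As \<open>ln (1 + x) \<le> x - x\<^sup>2 / 8\<close>
  for \<open>x \<le> 1\<close>, this bounds the empirical mean of \<open>h\<^sub>\<Delta>\<^sup>2\<close> by 8 times the empirical mean of \<open>h\<^sub>\<Delta>\<close>,
  provided that \<open>h\<^sub>\<Delta> \<le> 1\<close>. The proviso is removed by shrinking: the logarithm is concave, so the
  inequality persists, with a factor \<open>t\<close> in front of the quadratic term, if only \<open>t h\<^sub>\<Delta> \<le> 1\<close>. Because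
  \<open>\<bar>h\<^sub>v\<bar> \<le> \<parallel>h\<^sub>v\<parallel> / (\<kappa> T\<^sub>m\<^sub>i\<^sub>n)\<close>, one may take \<open>t = \<kappa> T\<^sub>m\<^sub>i\<^sub>n / \<parallel>h\<^sub>\<Delta>\<parallel>\<close> if this is below 1; but then the resulting
  bound on \<open>t \<parallel>h\<^sub>\<Delta>\<parallel>\<close> contradicts the assumed size of \<open>N\<close>. Hence \<open>t = 1\<close> is admissible
  (\<open>mle_l1norm_le\<close>).

  The probabilistic input is a comparison of empirical and true means, uniform in \<open>v\<close>. The
  functions \<open>h\<^sub>v\<close> with \<open>\<Sum>\<^sub>k v\<^sub>k = 0\<close> have mean zero and form a space of dimension at most \<open>K\<close>. Let
  \<open>f\<^sub>1, \<dots>, f\<^sub>m\<close> be an orthonormal basis of it; then \<open>\<Sum>\<^sub>a f\<^sub>a(j)\<^sup>2 \<le> B = 1 / (\<kappa> T\<^sub>m\<^sub>i\<^sub>n)\<^sup>2\<close>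
  (\<open>orthonormal_ratios_exist\<close>). By Cauchy--Schwarz in the coefficients it is enough to control two
  sums of independent centred vectors:
  \<^item> \<open>\<Sum>\<^sub>i f(j\<^sub>i)\<close> has squared length of mean \<open>m N\<close>, and Chebyshev's inequality for this squared length,
    by way of fourth moments, bounds it by \<open>4 K N\<close> outside an event of probability \<open>1 / K\<close>
    (\<open>prob_linear_fluctuation_ge\<close>).
  \<^item> \<open>\<Sum>\<^sub>i (f(j\<^sub>i) f(j\<^sub>i)\<^sup>T - I)\<close> has Frobenius norm at most \<open>N / 2\<close> outside an event of probability
    \<open>2 / K\<close> (\<open>prob_quadratic_fluctuation_ge\<close>). This needs \<open>N \<ge> 16 B K ln K\<close> and an exponential
    inequality for sums of random vectors in the style of Pinelis
    (\<open>expectation_cosh_L2_set_sample_sum_le\<close>).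

  The hypothesis on \<open>N\<close> implies that \<open>N\<close> is at least a constant times \<open>B K ln K\<close>, because the
  lower condition number is at most \<open>\<kappa>\<close>, \<open>\<kappa> \<le> 1\<close> and \<open>K T\<^sub>m\<^sub>i\<^sub>n \<le> 1\<close>. For \<open>K \<le> 4\<close> the asserted
  probability bound is not positive.
\<close>

section \<open>An exponential inequality for sums of random vectors\<close>

lemma power_weighted_mean_le:
  fixes x y t :: real
  assumes "0 \<le> x" "0 \<le> y" "0 \<le> t" "t \<le> 1"
  shows "((1 - t) * x + t * y) ^ n \<le> (1 - t) * x ^ n + t * y ^ n"
proof (induction n)
  case 0
  then show ?case by simp
next
  case (Suc n)
  let ?m = "(1 - t) * x + t * y"
  have m: "0 \<le> ?m" using assms by simp
  have "0 \<le> (x - y) * (x ^ n - y ^ n)"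
  proof (cases "x \<le> y")
    case True
    then show ?thesis using assms by (intro mult_nonpos_nonpos) (simp_all add: power_mono)
  next
    case False
    then show ?thesis using assms by (intro mult_nonneg_nonneg) (simp_all add: power_mono)
  qed
  then have "0 \<le> t * (1 - t) * ((x - y) * (x ^ n - y ^ n))"
    using assms by simp
  also have "\<dots> = (1 - t) * x ^ Suc n + t * y ^ Suc n - ?m * ((1 - t) * x ^ n + t * y ^ n)"
    by (simp add: algebra_simps)
  finally have "?m * ((1 - t) * x ^ n + t * y ^ n) \<le> (1 - t) * x ^ Suc n + t * y ^ Suc n"
    by simp
  moreover have "?m ^ Suc n \<le> ?m * ((1 - t) * x ^ n + t * y ^ n)"
    using mult_left_mono[OF Suc.IH m] by simp
  ultimately show ?case by linarith
qed

text \<open>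
  The function \<open>w \<mapsto> cosh (\<surd>w)\<close> has the power series \<open>\<Sum>n. w\<^sup>n / (2n)!\<close>, so it inherits convexity
  on \<open>w \<ge> 0\<close> from the monomials.
\<close>

lemma cosh_sqrt_weighted_mean_le:
  fixes x y t :: real
  assumes "0 \<le> x" "0 \<le> y" "0 \<le> t" "t \<le> 1"
  shows "cosh (sqrt ((1 - t) * x + t * y)) \<le> (1 - t) * cosh (sqrt x) + t * cosh (sqrt y)"
proof -
  let ?c = "\<lambda>x n. if even n then x ^ n /\<^sub>R fact n else (0::real)"
  have conv: "(\<lambda>n. (1 - t) * ?c (sqrt x) n + t * ?c (sqrt y) n) sums
      ((1 - t) * cosh (sqrt x) + t * cosh (sqrt y))"
    by (intro sums_add sums_mult cosh_converges)
  show ?thesis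
  proof (rule sums_le[OF _ cosh_converges conv])
    fix n
    have sq: "sqrt z ^ n = z ^ (n div 2)" if "even n" "0 \<le> z" for z
      using that by (elim evenE) (simp add: power_mult)
    show "?c (sqrt ((1 - t) * x + t * y)) n \<le> (1 - t) * ?c (sqrt x) n + t * ?c (sqrt y) n"
    proof (cases "even n")
      case True
      have c: "?c (sqrt z) n = z ^ (n div 2) / fact n" if "0 \<le> z" for z
        using True that by (simp add: sq divide_inverse_commute)
      have "((1 - t) * x + t * y) ^ (n div 2) / fact n
          \<le> ((1 - t) * x ^ (n div 2) + t * y ^ (n div 2)) / fact n"
        by (intro divide_right_mono power_weighted_mean_le assms) simp
      moreover have "0 \<le> (1 - t) * x + t * y"
        using assms by simp
      ultimately show ?thesis
        using assms by (simp only: c) (simp add: add_divide_distrib)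
    qed simp
  qed
qed

lemma le_sinh:
  fixes b :: real
  assumes "0 \<le> b"
  shows "b \<le> sinh b"
proof -
  have "(\<lambda>n. if n = 1 then b else 0) sums b"
    using sums_single[of 1 "\<lambda>_. b"] by simp
  then show ?thesis
    by (rule sums_le[rotated, OF _ sinh_converges]) (use assms in auto)
qed

text \<open>
  The scalar core of Pinelis' argument, with \<open>a = \<parallel>s\<parallel>\<close>, \<open>b = \<parallel>x\<parallel>\<close> and \<open>u = \<langle>s, x\<rangle>\<close>. As \<open>u\<close> ranges over
  \<open>[- a b, a b]\<close>, the left-hand side is \<open>cosh\<close> of a norm between \<open>\<bar>a - b\<bar>\<close> and \<open>a + b\<close>, and it lies
  below its chord by convexity of \<open>cosh \<circ> sqrt\<close>. The last term is linear in \<open>x\<close> for fixed \<open>s\<close>, so it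
  disappears when a centred \<open>x\<close> is averaged.
\<close>

lemma cosh_sqrt_add_le:
  fixes a b u :: real
  assumes "0 \<le> a" "0 \<le> b" "\<bar>u\<bar> \<le> a * b"
  shows "cosh (sqrt (a\<^sup>2 + 2 * u + b\<^sup>2)) \<le> cosh a * (exp b - b) + u * (sinh a / a)"
proof (cases "a = 0 \<or> b = 0")
  case True
  then have u: "u = 0" using assms by auto
  have e: "1 \<le> exp b - b" using exp_ge_add_one_self[of b] by linarith
  show ?thesis
  proof (cases "b = 0")
    case True
    then show ?thesis using u assms by simp
  next
    case False
    then have a: "a = 0" using True by simp
    have "cosh b + (sinh b - b) = exp b - b"
      by (simp add: cosh_plus_sinh[symmetric])
    moreover have "b \<le> sinh b"
      using assms(2) by (rule le_sinh)
    ultimately show ?thesis using u a assms by simp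
  qed
next
  case False
  then have ab: "0 < a" "0 < b" using assms by auto
  have sb: "b \<le> sinh b" using assms(2) by (rule le_sinh)
  \<comment> \<open>The weight of the end point \<open>(a + b)\<^sup>2\<close> in the chord.\<close>
  define t where "t = (1 + u / (a * b)) / 2"
  have t: "0 \<le> t" "t \<le> 1"
    using ab assms(3) by (auto simp: t_def field_simps abs_le_iff)
  have ut: "u = (2 * t - 1) * (a * b)" using ab by (simp add: t_def add_divide_distrib)
  have "a\<^sup>2 + 2 * u + b\<^sup>2 = (1 - t) * (a - b)\<^sup>2 + t * (a + b)\<^sup>2"
    unfolding ut by (simp add: power2_eq_square algebra_simps)
  then have "cosh (sqrt (a\<^sup>2 + 2 * u + b\<^sup>2))
      \<le> (1 - t) * cosh (sqrt ((a - b)\<^sup>2)) + t * cosh (sqrt ((a + b)\<^sup>2))"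
    using cosh_sqrt_weighted_mean_le[of "(a - b)\<^sup>2" "(a + b)\<^sup>2" t] t by simp
  also have "\<dots> = (1 - t) * cosh (a - b) + t * cosh (a + b)"
    by (simp only: real_sqrt_abs cosh_real_abs)
  also have "\<dots> = cosh a * cosh b + (2 * t - 1) * sinh a * sinh b"
    by (simp add: cosh_add cosh_diff algebra_simps)
  \<comment> \<open>The term in \<open>u\<close> is linear in \<open>x\<close> only after \<open>sinh b / b\<close> is replaced by 1; the excess is moved
    into the last summand.\<close>
  also have "\<dots> = cosh a * cosh b + u * (sinh a / a) + (2 * t - 1) * (sinh a * (sinh b - b))"
    using ab unfolding ut by (simp add: field_simps)
  also have "\<dots> \<le> cosh a * cosh b + u * (sinh a / a) + 1 * (cosh a * (sinh b - b))"
    using t sb ab sinh_le_cosh_real[of a]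
    by (intro add_left_mono mult_mono mult_nonneg_nonneg) auto
  also have "\<dots> = cosh a * (exp b - b) + u * (sinh a / a)"
    by (simp add: cosh_plus_sinh[symmetric] algebra_simps)
  finally show ?thesis .
qed

lemma finite_set_replicate_pmf:
  "finite (set_pmf q) \<Longrightarrow> finite (set_pmf (replicate_pmf n q))"
  by (simp add: set_replicate_pmf lists_eq_set finite_lists_length_eq)

lemma expectation_replicate_pmf_Suc:
  fixes g :: "'a list \<Rightarrow> real"
  assumes fin: "finite (set_pmf q)"
  shows "measure_pmf.expectation (replicate_pmf (Suc n) q) g =
    measure_pmf.expectation (replicate_pmf n q)
      (\<lambda>xs. measure_pmf.expectation q (\<lambda>x. g (x # xs)))"
proof -
  let ?R = "replicate_pmf n q"
  note int = integrable_measure_pmf_finite[OF finite_set_replicate_pmf[OF fin, of n]]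
  have "measure_pmf.expectation (replicate_pmf (Suc n) q) g =
      (\<Sum>x\<in>set_pmf q. pmf q x * measure_pmf.expectation ?R (\<lambda>xs. g (x # xs)))"
    using fin finite_set_replicate_pmf[OF fin, of n]
    by (simp add: pmf_expectation_bind[of "set_pmf q"] map_pmf_def[symmetric])
  also have "\<dots> = measure_pmf.expectation ?R (\<lambda>xs. \<Sum>x\<in>set_pmf q. pmf q x * g (x # xs))"
    by (simp add: Bochner_Integration.integral_sum int)
  also have "(\<lambda>xs. \<Sum>x\<in>set_pmf q. pmf q x * g (x # xs)) =
      (\<lambda>xs. measure_pmf.expectation q (\<lambda>x. g (x # xs)))"
    by (subst integral_measure_pmf[of "set_pmf q"]) (use fin in auto)
  finally show ?thesis .
qed

definition sample_sum :: "('a \<Rightarrow> 'i \<Rightarrow> real) \<Rightarrow> 'a list \<Rightarrow> 'i \<Rightarrow> real" where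
  "sample_sum X xs a = (\<Sum>x\<leftarrow>xs. X x a)"

lemma sample_sum_simps [simp]:
  "sample_sum X [] = (\<lambda>_. 0)"
  "sample_sum X (x # xs) = (\<lambda>a. sample_sum X xs a + X x a)"
  by (auto simp: sample_sum_def fun_eq_iff)

lemma L2_set_power2: "(L2_set v I)\<^sup>2 = (\<Sum>a\<in>I. (v a)\<^sup>2)"
  unfolding L2_set_def by (simp add: sum_nonneg)

lemma L2_set_add_power2:
  "(L2_set (\<lambda>a. s a + v a) I)\<^sup>2 = (L2_set s I)\<^sup>2 + 2 * (\<Sum>a\<in>I. s a * v a) + (L2_set v I)\<^sup>2"
  unfolding L2_set_power2
  by (simp add: power2_sum sum.distrib sum_distrib_left algebra_simps)

lemma abs_sum_mult_le_L2_set: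
  "\<bar>\<Sum>a\<in>I. s a * v a\<bar> \<le> L2_set s I * L2_set v I"
  by (rule order_trans[OF sum_abs]) (simp add: abs_mult L2_set_mult_ineq)

text \<open>
  Each summand multiplies the expected \<open>cosh\<close> of the norm by at most
  \<open>E (exp \<parallel>X\<parallel> - \<parallel>X\<parallel>)\<close>, which is \<open>1 + O(E \<parallel>X\<parallel>\<^sup>2)\<close> for bounded \<open>X\<close>, whatever the dimension of the vectors.
\<close>

lemma expectation_cosh_L2_set_sample_sum_le:
  assumes fin: "finite (set_pmf q)"
    and centred: "\<And>a. a \<in> I \<Longrightarrow> measure_pmf.expectation q (\<lambda>x. X x a) = 0"
    and M: "measure_pmf.expectation q (\<lambda>x. exp (L2_set (X x) I) - L2_set (X x) I) \<le> M"
  shows "measure_pmf.expectation (replicate_pmf n q) (\<lambda>xs. cosh (L2_set (sample_sum X xs) I))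
    \<le> M ^ n"
proof (induction n)
  case 0
  then show ?case by (simp add: L2_set_def)
next
  case (Suc n)
  note intq = integrable_measure_pmf_finite[OF fin]
  note intR = integrable_measure_pmf_finite[OF finite_set_replicate_pmf[OF fin, of n]]
  have e: "0 \<le> exp b - b" for b :: real using exp_ge_add_one_self[of b] by linarith
  then have "0 \<le> M"
    by (intro order_trans[OF _ M] integral_nonneg) simp
  have step: "measure_pmf.expectation q (\<lambda>x. cosh (L2_set (sample_sum X (x # xs)) I))
      \<le> cosh (L2_set (sample_sum X xs) I) * M" for xs
  proof -
    let ?s = "sample_sum X xs"
    let ?a = "L2_set ?s I"
    define k where "k = sinh ?a / ?a"
    have pt: "cosh (L2_set (sample_sum X (x # xs)) I)
        \<le> cosh ?a * (exp (L2_set (X x) I) - L2_set (X x) I)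
          + (\<Sum>a\<in>I. k * ?s a * X x a)" for x
    proof -
      have "L2_set (sample_sum X (x # xs)) I
          = sqrt (?a\<^sup>2 + 2 * (\<Sum>a\<in>I. ?s a * X x a) + (L2_set (X x) I)\<^sup>2)"
        by (subst L2_set_add_power2[symmetric]) simp
      also have "cosh \<dots> \<le> cosh ?a * (exp (L2_set (X x) I) - L2_set (X x) I)
          + (\<Sum>a\<in>I. ?s a * X x a) * (sinh ?a / ?a)"
        by (intro cosh_sqrt_add_le abs_sum_mult_le_L2_set) simp_all
      finally show ?thesis by (simp add: k_def[symmetric] sum_distrib_left mult_ac)
    qed
    have "measure_pmf.expectation q (\<lambda>x. cosh (L2_set (sample_sum X (x # xs)) I))
        \<le> measure_pmf.expectation q (\<lambda>x. cosh ?a * (exp (L2_set (X x) I) - L2_set (X x) I)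
          + (\<Sum>a\<in>I. k * ?s a * X x a))"
      by (intro integral_mono intq pt)
    also have "\<dots> = cosh ?a * measure_pmf.expectation q (\<lambda>x. exp (L2_set (X x) I) - L2_set (X x) I)"
      by (simp add: Bochner_Integration.integral_add Bochner_Integration.integral_sum intq centred
          del: Bochner_Integration.integral_diff)
    also have "\<dots> \<le> cosh ?a * M"
      by (intro mult_left_mono M) simp
    finally show ?thesis .
  qed
  have "measure_pmf.expectation (replicate_pmf (Suc n) q) (\<lambda>xs. cosh (L2_set (sample_sum X xs) I))
      \<le> measure_pmf.expectation (replicate_pmf n q) (\<lambda>xs. cosh (L2_set (sample_sum X xs) I) * M)"
    unfolding expectation_replicate_pmf_Suc[OF fin] by (intro integral_mono intR step)
  also have "\<dots> \<le> M ^ n * M"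
    using mult_right_mono[OF Suc.IH \<open>0 \<le> M\<close>] by simp
  finally show ?case by (simp add: mult.commute)
qed

lemma prob_ge_le_expectation:
  fixes g :: "'a \<Rightarrow> real"
  assumes "finite (set_pmf P)" "0 < c" "\<And>x. 0 \<le> g x"
  shows "measure_pmf.prob P {x. c \<le> g x} \<le> measure_pmf.expectation P g / c"
  using integral_Markov_inequality_measure[of "measure_pmf P" g "{}" c] assms
  by (simp add: integrable_measure_pmf_finite)

text \<open>
  A Bernstein bound without a dimensional factor: Markov's inequality for \<open>cosh (l \<parallel>S\<parallel>) \<ge> exp (l \<parallel>S\<parallel>) / 2\<close>,
  and \<open>exp x - x \<le> 1 + x\<^sup>2 \<le> exp (x\<^sup>2)\<close> for \<open>0 \<le> x \<le> 1\<close>.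
\<close>

lemma prob_L2_set_sample_sum_ge:
  assumes fin: "finite (set_pmf q)"
    and centred: "\<And>a. a \<in> I \<Longrightarrow> measure_pmf.expectation q (\<lambda>x. X x a) = 0"
    and var: "measure_pmf.expectation q (\<lambda>x. (L2_set (X x) I)\<^sup>2) \<le> V"
    and l: "0 < l" and bound: "\<And>x. x \<in> set_pmf q \<Longrightarrow> l * L2_set (X x) I \<le> 1"
  shows "measure_pmf.prob (replicate_pmf n q) {xs. r \<le> L2_set (sample_sum X xs) I}
    \<le> 2 * exp (real n * (l\<^sup>2 * V) - l * r)"
proof -
  let ?R = "replicate_pmf n q"
  let ?Y = "\<lambda>x a. l * X x a"
  note intq = integrable_measure_pmf_finite[OF fin]
  note finR = finite_set_replicate_pmf[OF fin, of n]
  have L2Y: "L2_set (?Y x) I = l * L2_set (X x) I" for x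
    using l by (simp add: L2_set_right_distrib)
  have scale: "sample_sum ?Y xs = (\<lambda>a. l * sample_sum X xs a)" for xs
    by (induction xs) (auto simp: algebra_simps)
  have L2S: "L2_set (sample_sum ?Y xs) I = l * L2_set (sample_sum X xs) I" for xs
    using l by (simp add: scale L2_set_right_distrib)
  have "measure_pmf.expectation q (\<lambda>x. exp (L2_set (?Y x) I) - L2_set (?Y x) I)
      \<le> measure_pmf.expectation q (\<lambda>x. 1 + l\<^sup>2 * (L2_set (X x) I)\<^sup>2)"
  proof (rule integral_mono_AE[OF intq intq], rule AE_pmfI)
    fix x assume "x \<in> set_pmf q"
    then have "exp (l * L2_set (X x) I) \<le> 1 + l * L2_set (X x) I + (l * L2_set (X x) I)\<^sup>2"
      using l bound by (intro exp_bound) auto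
    then show "exp (L2_set (?Y x) I) - L2_set (?Y x) I \<le> 1 + l\<^sup>2 * (L2_set (X x) I)\<^sup>2"
      by (simp add: L2Y power_mult_distrib)
  qed
  also have "\<dots> = 1 + l\<^sup>2 * measure_pmf.expectation q (\<lambda>x. (L2_set (X x) I)\<^sup>2)"
    by (simp add: intq)
  also have "\<dots> \<le> 1 + l\<^sup>2 * V"
    using var by (intro add_left_mono mult_left_mono) auto
  also have "\<dots> \<le> exp (l\<^sup>2 * V)"
    by (rule exp_ge_add_one_self)
  finally have M: "measure_pmf.expectation q (\<lambda>x. exp (L2_set (?Y x) I) - L2_set (?Y x) I)
      \<le> exp (l\<^sup>2 * V)" .
  have "{xs. r \<le> L2_set (sample_sum X xs) I}
      \<subseteq> {xs. exp (l * r) / 2 \<le> cosh (L2_set (sample_sum ?Y xs) I)}"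
  proof safe
    fix xs assume "r \<le> L2_set (sample_sum X xs) I"
    then have "exp (l * r) \<le> exp (L2_set (sample_sum ?Y xs) I)"
      using l by (simp add: L2S)
    also have "\<dots> \<le> 2 * cosh (L2_set (sample_sum ?Y xs) I)"
      by (simp add: cosh_field_def)
    finally show "exp (l * r) / 2 \<le> cosh (L2_set (sample_sum ?Y xs) I)" by simp
  qed
  then have "measure_pmf.prob ?R {xs. r \<le> L2_set (sample_sum X xs) I}
      \<le> measure_pmf.prob ?R {xs. exp (l * r) / 2 \<le> cosh (L2_set (sample_sum ?Y xs) I)}"
    by (intro measure_pmf.finite_measure_mono) auto
  also have "\<dots> \<le> measure_pmf.expectation ?R (\<lambda>xs. cosh (L2_set (sample_sum ?Y xs) I)) / (exp (l * r) / 2)"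
    by (intro prob_ge_le_expectation finR) auto
  also have "\<dots> \<le> exp (l\<^sup>2 * V) ^ n / (exp (l * r) / 2)"
    using centred
    by (intro divide_right_mono expectation_cosh_L2_set_sample_sum_le fin M) simp_all
  also have "\<dots> = 2 * exp (real n * (l\<^sup>2 * V) - l * r)"
    by (simp add: exp_diff exp_of_nat_mult[symmetric] mult.commute)
  finally show ?thesis .
qed

section \<open>Fourth moments of sums of isotropic vectors\<close>

lemma sum_list_linear_combination:
  fixes r :: real
  shows
  "(\<Sum>x\<leftarrow>xs. r + (\<Sum>i\<in>I. d i * X x i)) = length xs * r + (\<Sum>i\<in>I. d i * sample_sum X xs i)"
  by (induction xs) (simp_all add: sum.distrib algebra_simps)

context
  fixes q :: "'a pmf" and X :: "'a \<Rightarrow> 'i \<Rightarrow> real" and I :: "'i set"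
  assumes fin: "finite (set_pmf q)" and finI: "finite I"
    and centred: "\<And>a. a \<in> I \<Longrightarrow> measure_pmf.expectation q (\<lambda>x. X x a) = 0"
    and orth: "\<And>a b. a \<in> I \<Longrightarrow> b \<in> I \<Longrightarrow>
      measure_pmf.expectation q (\<lambda>x. X x a * X x b) = of_bool (a = b)"
begin

lemma expectation_power2_isotropic:
  "measure_pmf.expectation q (\<lambda>x. (\<Sum>a\<in>I. s a * X x a)\<^sup>2) = (L2_set s I)\<^sup>2"
proof -
  note intq = integrable_measure_pmf_finite[OF fin]
  have "measure_pmf.expectation q (\<lambda>x. (\<Sum>a\<in>I. s a * X x a)\<^sup>2)
      = measure_pmf.expectation q (\<lambda>x. \<Sum>a\<in>I. \<Sum>b\<in>I. s a * s b * (X x a * X x b))"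
    by (simp add: power2_eq_square sum_product algebra_simps)
  also have "\<dots> = (\<Sum>a\<in>I. \<Sum>b\<in>I. s a * s b * of_bool (a = b))"
    by (simp add: Bochner_Integration.integral_sum intq orth)
  also have "\<dots> = (L2_set s I)\<^sup>2"
    using finI by (simp add: L2_set_power2 of_bool_def power2_eq_square[of "s _"] if_distrib cong: if_cong)
  finally show ?thesis .
qed

lemma expectation_L2_set_power2_isotropic:
  "measure_pmf.expectation q (\<lambda>x. (L2_set (X x) I)\<^sup>2) = card I"
  unfolding L2_set_power2
  by (simp add: Bochner_Integration.integral_sum integrable_measure_pmf_finite[OF fin]
      power2_eq_square orth)

lemma expectation_sample_sum:
  "a \<in> I \<Longrightarrow> measure_pmf.expectation (replicate_pmf n q) (\<lambda>xs. sample_sum X xs a) = 0"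
proof (induction n)
  case (Suc n)
  then show ?case
    by (simp add: expectation_replicate_pmf_Suc[OF fin] integrable_measure_pmf_finite[OF fin] centred
        del: replicate_pmf.simps)
qed simp

lemma expectation_L2_set_sample_sum_power2:
  "measure_pmf.expectation (replicate_pmf n q) (\<lambda>xs. (L2_set (sample_sum X xs) I)\<^sup>2) = n * card I"
proof (induction n)
  case 0
  then show ?case by (simp add: L2_set_def)
next
  case (Suc n)
  note intq = integrable_measure_pmf_finite[OF fin]
  note intR = integrable_measure_pmf_finite[OF finite_set_replicate_pmf[OF fin, of n]]
  show ?case
    by (simp add: expectation_replicate_pmf_Suc[OF fin] L2_set_add_power2 intq intR
        Bochner_Integration.integral_sum centred expectation_L2_set_power2_isotropic Suc.IH
        algebra_simps del: replicate_pmf.simps)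
qed

text \<open>
  In the expansion of \<open>\<parallel>s + x\<parallel>\<^sup>4\<close> the term \<open>4 \<langle>s, x\<rangle> \<parallel>x\<parallel>\<^sup>2\<close> need not vanish on averaging over \<open>x\<close>, but
  what remains is linear in \<open>s\<close>, and the sum \<open>s\<close> of the earlier vectors is centred.
\<close>

lemma expectation_L2_set_sample_sum_power4_le:
  assumes M4: "measure_pmf.expectation q (\<lambda>x. (L2_set (X x) I) ^ 4) \<le> M"
  shows "measure_pmf.expectation (replicate_pmf n q) (\<lambda>xs. (L2_set (sample_sum X xs) I) ^ 4)
    \<le> (real n)\<^sup>2 * ((card I)\<^sup>2 + 2 * card I) + n * M"
proof (induction n)
  case 0
  then show ?case by (simp add: L2_set_def)
next
  case (Suc n)
  let ?d = "real (card I)"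
  note intq = integrable_measure_pmf_finite[OF fin]
  note intR = integrable_measure_pmf_finite[OF finite_set_replicate_pmf[OF fin, of n]]
  let ?w = "\<lambda>a. measure_pmf.expectation q (\<lambda>x. X x a * (L2_set (X x) I)\<^sup>2)"
  let ?Q = "\<lambda>xs. L2_set (sample_sum X xs) I"
  have step: "measure_pmf.expectation q (\<lambda>x. (?Q (x # xs)) ^ 4)
      = ?Q xs ^ 4 + (2 * ?d + 4) * (?Q xs)\<^sup>2
        + measure_pmf.expectation q (\<lambda>x. (L2_set (X x) I) ^ 4)
        + 4 * (\<Sum>a\<in>I. ?w a * sample_sum X xs a)" for xs
  proof -
    let ?s = "sample_sum X xs"
    let ?u = "\<lambda>x. \<Sum>a\<in>I. ?s a * X x a"
    let ?V = "\<lambda>x. (L2_set (X x) I)\<^sup>2"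
    have p4: "z ^ 4 = (z\<^sup>2)\<^sup>2" for z :: real
      by simp
    have "(?Q (x # xs)) ^ 4 = ?Q xs ^ 4 + 2 * (?Q xs)\<^sup>2 * ?V x + L2_set (X x) I ^ 4
        + 4 * (?u x)\<^sup>2 + 4 * (?Q xs)\<^sup>2 * ?u x + 4 * (\<Sum>a\<in>I. ?s a * (X x a * ?V x))" for x
    proof -
      have uV: "(\<Sum>a\<in>I. ?s a * (X x a * ?V x)) = ?u x * ?V x"
        by (simp add: sum_distrib_right mult.assoc)
      have "(?Q (x # xs)) ^ 4 = ((?Q xs)\<^sup>2 + 2 * ?u x + ?V x)\<^sup>2"
        by (simp only: p4 sample_sum_simps L2_set_add_power2)
      then show ?thesis
        unfolding uV by (simp add: power2_eq_square power4_eq_xxxx algebra_simps)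
    qed
    then have "measure_pmf.expectation q (\<lambda>x. (?Q (x # xs)) ^ 4)
        = ?Q xs ^ 4 + 2 * (?Q xs)\<^sup>2 * measure_pmf.expectation q ?V
          + measure_pmf.expectation q (\<lambda>x. (L2_set (X x) I) ^ 4)
          + 4 * measure_pmf.expectation q (\<lambda>x. (?u x)\<^sup>2)
          + 4 * (?Q xs)\<^sup>2 * (\<Sum>a\<in>I. ?s a * measure_pmf.expectation q (\<lambda>x. X x a))
          + 4 * (\<Sum>a\<in>I. ?s a * ?w a)"
      by (simp add: Bochner_Integration.integral_sum intq)
    then show ?thesis
      unfolding expectation_L2_set_power2_isotropic expectation_power2_isotropic
      by (simp add: centred algebra_simps)
  qed
  have "measure_pmf.expectation (replicate_pmf (Suc n) q) (\<lambda>xs. (?Q xs) ^ 4)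
      = measure_pmf.expectation (replicate_pmf n q) (\<lambda>xs. ?Q xs ^ 4 + (2 * ?d + 4) * (?Q xs)\<^sup>2
        + measure_pmf.expectation q (\<lambda>x. (L2_set (X x) I) ^ 4)
        + 4 * (\<Sum>a\<in>I. ?w a * sample_sum X xs a))"
    unfolding expectation_replicate_pmf_Suc[OF fin] step ..
  also have "\<dots> = measure_pmf.expectation (replicate_pmf n q) (\<lambda>xs. ?Q xs ^ 4)
      + (2 * ?d + 4) * measure_pmf.expectation (replicate_pmf n q) (\<lambda>xs. (?Q xs)\<^sup>2)
      + measure_pmf.expectation q (\<lambda>x. (L2_set (X x) I) ^ 4)
      + 4 * (\<Sum>a\<in>I. ?w a * measure_pmf.expectation (replicate_pmf n q) (\<lambda>xs. sample_sum X xs a))"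
    by (simp add: Bochner_Integration.integral_sum intR)
  also have "\<dots> \<le> ((real n)\<^sup>2 * ((card I)\<^sup>2 + 2 * card I) + n * M) + (2 * ?d + 4) * (n * ?d) + M"
    using Suc.IH M4 by (simp add: expectation_sample_sum expectation_L2_set_sample_sum_power2)
  also have "\<dots> \<le> (real (Suc n))\<^sup>2 * ((card I)\<^sup>2 + 2 * card I) + Suc n * M"
    by (simp add: power2_eq_square algebra_simps)
  finally show ?case .
qed

text \<open>
  Chebyshev's inequality for \<open>\<parallel>S\<parallel>\<^sup>2\<close>. The leading terms \<open>(n d)\<^sup>2\<close> of the fourth moment and of the squared
  mean cancel, which leaves a variance linear in the dimension \<open>d\<close>.
\<close>

lemma prob_L2_set_sample_sum_power2_ge:
  assumes M4: "measure_pmf.expectation q (\<lambda>x. (L2_set (X x) I) ^ 4) \<le> M" and r: "0 < r"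
  shows "measure_pmf.prob (replicate_pmf n q)
      {xs. real n * card I + r \<le> (L2_set (sample_sum X xs) I)\<^sup>2}
    \<le> (2 * card I * (real n)\<^sup>2 + n * M) / r\<^sup>2"
proof -
  let ?R = "replicate_pmf n q"
  let ?Q = "\<lambda>xs. L2_set (sample_sum X xs) I"
  let ?nd = "real n * card I"
  note finR = finite_set_replicate_pmf[OF fin, of n]
  note intR = integrable_measure_pmf_finite[OF finR]
  have "measure_pmf.prob ?R {xs. ?nd + r \<le> (?Q xs)\<^sup>2}
      \<le> measure_pmf.prob ?R {xs. r\<^sup>2 \<le> ((?Q xs)\<^sup>2 - ?nd)\<^sup>2}"
    using r by (intro measure_pmf.finite_measure_mono) (auto intro!: power_mono)
  also have "\<dots> \<le> measure_pmf.expectation ?R (\<lambda>xs. ((?Q xs)\<^sup>2 - ?nd)\<^sup>2) / r\<^sup>2"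
    using r by (intro prob_ge_le_expectation finR) auto
  also have "(\<lambda>xs. ((?Q xs)\<^sup>2 - ?nd)\<^sup>2) = (\<lambda>xs. ?Q xs ^ 4 - 2 * ?nd * (?Q xs)\<^sup>2 + ?nd\<^sup>2)"
    by (simp add: power2_diff algebra_simps flip: power_mult)
  also have "measure_pmf.expectation ?R \<dots>
      = measure_pmf.expectation ?R (\<lambda>xs. ?Q xs ^ 4) - ?nd\<^sup>2"
    by (simp add: intR expectation_L2_set_sample_sum_power2) (simp add: power2_eq_square)
  also have "\<dots> \<le> 2 * card I * (real n)\<^sup>2 + n * M"
    using expectation_L2_set_sample_sum_power4_le[OF M4, of n]
    by (simp add: power_mult_distrib algebra_simps)
  finally show ?thesis using r by (simp add: divide_right_mono)
qed

end

section \<open>Orthonormal families\<close>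

lemma linear_combination_closed:
  fixes f :: "nat \<Rightarrow> 'a \<Rightarrow> real"
  assumes closed: "\<And>f g c d. f \<in> W \<Longrightarrow> g \<in> W \<Longrightarrow> (\<lambda>j. c * f j + d * g j) \<in> W"
    and "g \<in> W" "\<And>a. a < m \<Longrightarrow> f a \<in> W"
  shows "(\<lambda>j. g j + (\<Sum>a<m. c a * f a j)) \<in> W"
  using assms(3)
proof (induction m)
  case 0
  then show ?case using \<open>g \<in> W\<close> by simp
next
  case (Suc m)
  then have "(\<lambda>j. 1 * (g j + (\<Sum>a<m. c a * f a j)) + c m * f m j) \<in> W"
    by (intro closed) auto
  then show ?case by (simp add: add.assoc)
qed

text \<open>
  Gram--Schmidt for functions in the weighted space \<open>L\<^sup>2(w)\<close>, staying inside a space \<open>W\<close> of functions. The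
  \<open>h k\<close> may be linearly dependent: a residual of norm zero is dropped. It is known to
  vanish only where the weight is positive, so the expansion is asserted only there.
\<close>

lemma orthonormal_family_exists:
  fixes w :: "'a \<Rightarrow> real" and h :: "nat \<Rightarrow> 'a \<Rightarrow> real"
  assumes fin: "finite A" and w: "\<And>j. j \<in> A \<Longrightarrow> 0 \<le> w j"
    and h: "\<And>k. k < K \<Longrightarrow> h k \<in> W"
    and closed: "\<And>f g c d. f \<in> W \<Longrightarrow> g \<in> W \<Longrightarrow> (\<lambda>j. c * f j + d * g j) \<in> W"
  shows "\<exists>m f. m \<le> K \<and> (\<forall>a<m. f a \<in> W) \<and>
    (\<forall>a<m. \<forall>b<m. (\<Sum>j\<in>A. w j * (f a j * f b j)) = of_bool (a = b)) \<and>
    (\<forall>k<K. \<exists>c. \<forall>j\<in>A. w j > 0 \<longrightarrow> h k j = (\<Sum>a<m. c a * f a j))"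
  using h
proof (induction K)
  case 0
  show ?case by (intro exI[of _ 0]) auto
next
  case (Suc K)
  then obtain m f where m: "m \<le> K" and fW: "\<And>a. a < m \<Longrightarrow> f a \<in> W"
    and orth: "\<And>a b. a < m \<Longrightarrow> b < m \<Longrightarrow> (\<Sum>j\<in>A. w j * (f a j * f b j)) = of_bool (a = b)"
    and span: "\<And>k. k < K \<Longrightarrow> \<exists>c. \<forall>j\<in>A. w j > 0 \<longrightarrow> h k j = (\<Sum>a<m. c a * f a j)"
    by fastforce
  define c where "c a = (\<Sum>j\<in>A. w j * (h K j * f a j))" for a
  define r where "r j = h K j - (\<Sum>a<m. c a * f a j)" for j
  define n where "n = (\<Sum>j\<in>A. w j * (r j)\<^sup>2)"
  have "(\<lambda>j. h K j + (\<Sum>a<m. (- c a) * f a j)) \<in> W"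
    by (rule linear_combination_closed[OF closed]) (use Suc.prems fW in auto)
  then have rW: "r \<in> W"
    by (simp add: r_def[abs_def] sum_negf)
  have r_orth: "(\<Sum>j\<in>A. w j * (r j * f b j)) = 0" if b: "b < m" for b
  proof -
    have "(\<Sum>j\<in>A. w j * (r j * f b j))
        = c b - (\<Sum>a<m. c a * (\<Sum>j\<in>A. w j * (f a j * f b j)))"
      unfolding r_def sum_distrib_left
      by (subst sum.swap) (simp add: c_def algebra_simps sum_subtractf sum_distrib_left)
    also have "\<dots> = 0"
      using b by (simp add: orth of_bool_def if_distrib cong: if_cong)
    finally show ?thesis .
  qed
  have n0: "0 \<le> n" unfolding n_def by (intro sum_nonneg mult_nonneg_nonneg w) auto
  show ?case
  proof (cases "n = 0")
    case True
    then have "r j = 0" if "j \<in> A" "w j > 0" for j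
      using that fin w by (auto simp: n_def sum_nonneg_eq_0_iff)
    then have "\<forall>j\<in>A. w j > 0 \<longrightarrow> h K j = (\<Sum>a<m. c a * f a j)"
      by (simp add: r_def)
    then have "\<forall>k<Suc K. \<exists>c. \<forall>j\<in>A. w j > 0 \<longrightarrow> h k j = (\<Sum>a<m. c a * f a j)"
      using span by (auto simp: less_Suc_eq)
    then show ?thesis using m fW orth by (intro exI[of _ m] exI[of _ f]) auto
  next
    case False
    with n0 have n: "0 < n" by simp
    define f' where "f' = f(m := (\<lambda>j. r j / sqrt n))"
    have "(\<lambda>j. (1 / sqrt n) * r j + 0 * r j) \<in> W"
      by (intro closed rW)
    then have 1: "\<forall>a<Suc m. f' a \<in> W"
      using fW by (auto simp: f'_def less_Suc_eq)
    have rf: "(\<Sum>j\<in>A. w j * (f' m j * f' b j)) = 0" "(\<Sum>j\<in>A. w j * (f' b j * f' m j)) = 0"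
      if "b < m" for b
      using r_orth[OF that] that
      by (auto simp: f'_def sum_divide_distrib[symmetric] mult.commute[of "f b _"])
    have rr: "(\<Sum>j\<in>A. w j * (f' m j * f' m j)) = 1"
    proof -
      have "r j / sqrt n * (r j / sqrt n) = (r j)\<^sup>2 / n" for j
        using n by (simp add: power2_eq_square)
      then show ?thesis
        using n by (simp add: f'_def sum_divide_distrib[symmetric] n_def[symmetric])
    qed
    have 2: "\<forall>a<Suc m. \<forall>b<Suc m. (\<Sum>j\<in>A. w j * (f' a j * f' b j)) = of_bool (a = b)"
      using rf rr orth by (auto simp: less_Suc_eq f'_def)
    have 3: "\<forall>k<Suc K. \<exists>c. \<forall>j\<in>A. w j > 0 \<longrightarrow> h k j = (\<Sum>a<Suc m. c a * f' a j)"
    proof (intro allI impI)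
      fix k assume "k < Suc K"
      then consider "k < K" | "k = K" by linarith
      then show "\<exists>c. \<forall>j\<in>A. w j > 0 \<longrightarrow> h k j = (\<Sum>a<Suc m. c a * f' a j)"
      proof cases
        case 1
        then obtain c' where "\<forall>j\<in>A. w j > 0 \<longrightarrow> h k j = (\<Sum>a<m. c' a * f a j)"
          using span by blast
        then show ?thesis
          by (intro exI[of _ "c'(m := 0)"]) (simp add: f'_def)
      next
        case 2
        then show ?thesis
          using n by (intro exI[of _ "c(m := sqrt n)"]) (simp add: f'_def r_def)
      qed
    qed
    show ?thesis using m 1 2 3 by (intro exI[of _ "Suc m"] exI[of _ f']) auto
  qed
qed

section \<open>Consequences of nonnegative log-likelihood ratios\<close>

text \<open>
  Take logarithms in \<open>1 + x \<le> (1 + x / 2 - x\<^sup>2 / 16)\<^sup>2\<close>.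
\<close>

lemma ln_add_one_le_quadratic:
  fixes x :: real
  assumes "-1 < x" "x \<le> 1"
  shows "ln (1 + x) \<le> x - x\<^sup>2 / 8"
proof -
  have "x\<^sup>2 * x \<le> x\<^sup>2 * 2"
    using assms by (intro mult_left_mono) auto
  then have x3: "x ^ 3 \<le> 2 * x\<^sup>2"
    by (simp add: power3_eq_cube power2_eq_square)
  have "\<bar>x\<bar> * \<bar>x\<bar> \<le> 1 * 1"
    using assms by (intro mult_mono) auto
  then have x2: "x\<^sup>2 \<le> 1"
    by (simp add: power2_eq_square)
  have "(1 + x / 2 - x\<^sup>2 / 16)\<^sup>2 = 1 + x + (x\<^sup>2 / 8 - x ^ 3 / 16) + x ^ 4 / 256"
    by (simp add: power2_eq_square power3_eq_cube power4_eq_xxxx algebra_simps)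
  have "1 + x \<le> (1 + x / 2 - x\<^sup>2 / 16)\<^sup>2"
  proof -
    have "0 \<le> x ^ 4" by simp
    with \<open>(1 + x / 2 - x\<^sup>2 / 16)\<^sup>2 = _\<close> x3 show ?thesis by linarith
  qed
  then have "ln (1 + x) \<le> ln ((1 + x / 2 - x\<^sup>2 / 16)\<^sup>2)"
    using assms by (intro ln_mono) auto
  also have "\<dots> = 2 * ln (1 + (x / 2 - x\<^sup>2 / 16))"
    using assms x2 by (subst ln_realpow) (auto simp: add_diff_eq)
  also have "\<dots> \<le> 2 * (x / 2 - x\<^sup>2 / 16)"
    using assms x2 by (intro mult_left_mono ln_add_one_self_le_self2) auto
  finally show ?thesis by simp
qed

section \<open>The condition number\<close>

lemma l1norm_nonneg: "0 \<le> l1norm I v"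
  by (simp add: l1norm_def sum_nonneg)

lemma kappa_ratio_nonneg: "0 \<le> l1norm U (row_prod K A v) / l1norm {..<K} v"
  by (simp add: l1norm_nonneg)

lemma kappa_mult_l1norm_le:
  assumes "v \<in> Rvec K"
  shows "kappa K A U K * l1norm {..<K} v \<le> l1norm U (row_prod K A v)"
proof (cases "v = (\<lambda>_. 0)")
  case True
  then show ?thesis by (simp add: l1norm_def)
next
  case False
  then obtain k where k: "v k \<noteq> 0" by auto
  then have "k < K" using assms by (auto simp: Rvec_def not_less[symmetric])
  then have pos: "0 < l1norm {..<K} v"
    unfolding l1norm_def using k by (intro sum_pos2[of _ k]) auto
  have "v \<in> cone K {..<K}"
    using assms False by (simp add: cone_def l1norm_nonneg) (simp add: l1norm_def sum_nonneg)
  then have "kappa K A U K \<le> l1norm U (row_prod K A v) / l1norm {..<K} v"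
    unfolding kappa_def
    by (intro cInf_lower bdd_belowI[of _ 0]) (auto intro!: kappa_ratio_nonneg exI[of _ "{..<K}"] exI[of _ v])
  then show ?thesis using pos by (simp add: field_simps)
qed

definition unit_vec :: "nat \<Rightarrow> nat \<Rightarrow> real" where
  "unit_vec k = (\<lambda>i. of_bool (i = k))"

lemma unit_vec_simps:
  "k < K \<Longrightarrow> unit_vec k \<in> Rvec K"
  "k < K \<Longrightarrow> row_prod K A (unit_vec k) j = A j k"
  "k < K \<Longrightarrow> sum (unit_vec k) {..<K} = 1"
  "k < K \<Longrightarrow> l1norm {..<K} (unit_vec k) = 1"
  by (auto simp: unit_vec_def Rvec_def row_prod_def l1norm_def of_bool_def if_distrib cong: if_cong)

lemma kappa_mono:
  assumes "1 \<le> K" "finite U'" "U \<subseteq> U'"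
  shows "kappa K A U K \<le> kappa K A U' K"
  unfolding kappa_def
proof (rule cInf_mono)
  have "unit_vec 0 \<in> cone K {..<K}"
    using assms(1) unit_vec_simps[of 0 K]
    by (auto simp: cone_def unit_vec_def fun_eq_iff l1norm_def)
  then show "{l1norm U' (row_prod K A v) / l1norm {..<K} v |S v.
      S \<subseteq> {..<K} \<and> card S \<le> K \<and> v \<in> cone K S} \<noteq> {}"
    by (auto intro!: exI[of _ "{..<K}"])
  show "bdd_below {l1norm U (row_prod K A v) / l1norm {..<K} v |S v.
      S \<subseteq> {..<K} \<and> card S \<le> K \<and> v \<in> cone K S}"
    by (rule bdd_belowI[of _ 0]) (auto intro!: kappa_ratio_nonneg)
next
  fix b assume "b \<in> {l1norm U' (row_prod K A v) / l1norm {..<K} v |S v.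
      S \<subseteq> {..<K} \<and> card S \<le> K \<and> v \<in> cone K S}"
  then obtain S v where b: "b = l1norm U' (row_prod K A v) / l1norm {..<K} v"
    and Sv: "S \<subseteq> {..<K}" "card S \<le> K" "v \<in> cone K S" by blast
  have "l1norm U (row_prod K A v) \<le> l1norm U' (row_prod K A v)"
    unfolding l1norm_def using assms by (intro sum_mono2) auto
  then have "l1norm U (row_prod K A v) / l1norm {..<K} v \<le> b"
    unfolding b by (intro divide_right_mono l1norm_nonneg)
  then show "\<exists>a\<in>{l1norm U (row_prod K A v) / l1norm {..<K} v |S v.
      S \<subseteq> {..<K} \<and> card S \<le> K \<and> v \<in> cone K S}. a \<le> b"
    using Sv by blast
qed

lemma sum_list_map_count:
  fixes g :: "'a \<Rightarrow> real"
  shows "sum_list (map g xs) = (\<Sum>x\<in>set xs. real (count_list xs x) * g x)"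
proof (induction xs)
  case (Cons x xs)
  have "(\<Sum>y\<in>set (x # xs). real (count_list (x # xs) y) * g y)
      = (\<Sum>y\<in>set (x # xs). real (count_list xs y) * g y + (if y = x then g y else 0))"
    by (intro sum.cong) (auto simp: algebra_simps)
  also have "\<dots> = (\<Sum>y\<in>set (x # xs). real (count_list xs y) * g y) + g x"
    by (simp add: sum.distrib del: set_simps) simp
  also have "(\<Sum>y\<in>set (x # xs). real (count_list xs y) * g y)
      = (\<Sum>y\<in>set xs. real (count_list xs y) * g y)"
    by (intro sum.mono_neutral_right) auto
  finally show ?case using Cons.IH by simp
qed simp

text \<open>
  The point is the free parameter \<open>t\<close>: nonnegativity of \<open>\<Sum> ln (1 + h)\<close> passes to \<open>\<Sum> ln (1 + t h)\<close> by
  concavity, and \<open>t h\<close> may be made as small as the quadratic bound on the logarithm requires.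
\<close>

lemma sum_power2_le_of_sum_ln_nonneg:
  fixes h :: "'a \<Rightarrow> real"
  assumes pos: "\<And>x. x \<in> set xs \<Longrightarrow> 0 < 1 + h x"
    and nonneg: "0 \<le> (\<Sum>x\<leftarrow>xs. ln (1 + h x))"
    and t: "0 < t" "t \<le> 1" and th: "\<And>x. x \<in> set xs \<Longrightarrow> t * h x \<le> 1"
  shows "t * (\<Sum>x\<leftarrow>xs. (h x)\<^sup>2) \<le> 8 * (\<Sum>x\<leftarrow>xs. h x)"
proof -
  have pt: "t * ln (1 + h x) \<le> t * (h x - t * (h x)\<^sup>2 / 8)" if x: "x \<in> set xs" for x
  proof -
    have "0 < t * (1 + h x)" using pos[OF x] t by simp
    then have gt: "- 1 < t * h x" using t by (simp add: algebra_simps)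
    have "(1 - t) * ln 1 + t * ln (1 + h x) \<le> ln ((1 - t) *\<^sub>R 1 + t *\<^sub>R (1 + h x))"
      by (rule concave_onD[OF ln_concave]) (use pos[OF x] t in auto)
    then have "t * ln (1 + h x) \<le> ln (1 + t * h x)"
      by (simp add: algebra_simps)
    also have "\<dots> \<le> t * h x - (t * h x)\<^sup>2 / 8"
      by (intro ln_add_one_le_quadratic th x gt)
    finally show ?thesis by (simp add: power2_eq_square algebra_simps)
  qed
  have "0 \<le> t * (\<Sum>x\<leftarrow>xs. ln (1 + h x))" using nonneg t by simp
  also have "\<dots> = (\<Sum>x\<leftarrow>xs. t * ln (1 + h x))" by (simp add: sum_list_const_mult)
  also have "\<dots> \<le> (\<Sum>x\<leftarrow>xs. t * (h x - t * (h x)\<^sup>2 / 8))"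
    by (intro sum_list_mono pt)
  also have "\<dots> = t * ((\<Sum>x\<leftarrow>xs. h x) - t * (\<Sum>x\<leftarrow>xs. (h x)\<^sup>2) / 8)"
    by (induction xs) (simp_all add: algebra_simps add_divide_distrib)
  finally show ?thesis using t by (simp add: zero_le_mult_iff)
qed

section \<open>Geometry of the mixture model\<close>

locale mixture =
  fixes p K :: nat and A :: "nat \<Rightarrow> nat \<Rightarrow> real" and T :: "nat \<Rightarrow> real"
  assumes K: "1 \<le> K" and A: "columns_in_simplex p K A" and T: "T \<in> sparse_simplex K K"
    and kappa_pos: "0 < kappa K A (J_upper p (mat_vec p K A T)) K"
begin

abbreviation \<pi> where "\<pi> \<equiv> mat_vec p K A T"
abbreviation \<kappa> where "\<kappa> \<equiv> kappa K A (J_upper p \<pi>) K"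
abbreviation \<tau> where "\<tau> \<equiv> Tmin K T"
text \<open>
  An upper bound for the largest leverage \<open>sup\<^sub>v h\<^sub>v(j)\<^sup>2 / \<parallel>h\<^sub>v\<parallel>\<^sup>2\<close> of an observation \<open>j\<close>.
\<close>

abbreviation leverage_bound where "leverage_bound \<equiv> 1 / (\<kappa> * \<tau>)\<^sup>2"
abbreviation q where "q \<equiv> categorical_pmf p \<pi>"

text \<open>
  The function \<open>h\<^sub>v\<close> of the introduction; division by zero makes it \<open>0\<close> on cells of probability zero.
\<close>

definition ratio :: "(nat \<Rightarrow> real) \<Rightarrow> nat \<Rightarrow> real" where
  "ratio v j = row_prod K A v j / \<pi> j"

lemma T_simplex: "T \<in> prob_simplex K" and supp_T: "supp K T = {..<K}"
proof -
  show "T \<in> prob_simplex K" using T by (simp add: sparse_simplex_def)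
  have "supp K T \<subseteq> {..<K}" "card (supp K T) = card {..<K}"
    using T by (auto simp: sparse_simplex_def supp_def)
  then show "supp K T = {..<K}" by (intro card_subset_eq) auto
qed

lemma A_nonneg: "k < K \<Longrightarrow> j < p \<Longrightarrow> 0 \<le> A j k"
  and A_column: "k < K \<Longrightarrow> (\<Sum>j<p. A j k) = 1"
  using A by (auto simp: columns_in_simplex_def prob_simplex_def)

lemma Tmin_le: "k < K \<Longrightarrow> \<tau> \<le> T k"
  unfolding Tmin_def supp_T by (intro Min_le) auto

lemma Tmin_pos: "0 < \<tau>"
proof -
  have "0 < T k" if "k < K" for k
  proof -
    have "T k \<noteq> 0" using that supp_T by (auto simp: supp_def)
    moreover have "0 \<le> T k" using that T_simplex by (simp add: prob_simplex_def)
    ultimately show ?thesis by simp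
  qed
  moreover have "\<tau> \<in> T ` {..<K}"
    unfolding Tmin_def supp_T using K by (intro Min_in) (auto simp: lessThan_empty_iff)
  ultimately show ?thesis by auto
qed

lemma K_Tmin_le: "K * \<tau> \<le> 1"
proof -
  have "(\<Sum>k<K. \<tau>) \<le> (\<Sum>k<K. T k)" by (intro sum_mono Tmin_le) auto
  then show ?thesis using T_simplex by (simp add: prob_simplex_def)
qed

lemma Tmin_le_1: "\<tau> \<le> 1"
proof -
  have "1 * \<tau> \<le> K * \<tau>" using K Tmin_pos by (intro mult_right_mono) auto
  then show ?thesis using K_Tmin_le by simp
qed

lemma Pi_simplex: "\<pi> \<in> prob_simplex p"
  by (rule mat_vec_in_prob_simplex[OF A T_simplex])

lemma Pi_nonneg: "0 \<le> \<pi> j"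
  using Pi_simplex by (cases "j < p") (auto simp: prob_simplex_def Rvec_def)

lemma Pi_sum: "(\<Sum>j<p. \<pi> j) = 1"
  using Pi_simplex by (simp add: prob_simplex_def)

lemma Pi_eq: "j < p \<Longrightarrow> \<pi> j = row_prod K A T j"
  by (simp add: mat_vec_def)

text \<open>
  Both sides compare with \<open>\<Sum>\<^sub>k A\<^sub>j\<^sub>k\<close>: the entries of \<open>v\<close> are at most \<open>\<parallel>v\<parallel>\<^sub>1\<close> in modulus, those of \<open>T\<close> at
  least \<open>\<tau>\<close>.
\<close>

lemma Tmin_abs_row_prod_le:
  assumes "j < p"
  shows "\<tau> * \<bar>row_prod K A v j\<bar> \<le> l1norm {..<K} v * \<pi> j"
proof -
  have "\<tau> * \<bar>row_prod K A v j\<bar> \<le> \<tau> * (\<Sum>k<K. A j k * l1norm {..<K} v)"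
  proof (intro mult_left_mono)
    have "\<bar>row_prod K A v j\<bar> \<le> (\<Sum>k<K. \<bar>A j k * v k\<bar>)"
      unfolding row_prod_def by (rule sum_abs)
    also have "\<dots> \<le> (\<Sum>k<K. A j k * l1norm {..<K} v)"
    proof (rule sum_mono)
      fix k assume k: "k \<in> {..<K}"
      then have "\<bar>v k\<bar> \<le> l1norm {..<K} v"
        unfolding l1norm_def by (intro member_le_sum) auto
      then show "\<bar>A j k * v k\<bar> \<le> A j k * l1norm {..<K} v"
        using A_nonneg[of k j] k assms by (simp add: abs_mult mult_left_mono)
    qed
    finally show "\<bar>row_prod K A v j\<bar> \<le> (\<Sum>k<K. A j k * l1norm {..<K} v)" .
  qed (use Tmin_pos in simp)
  also have "\<dots> = l1norm {..<K} v * (\<Sum>k<K. A j k * \<tau>)"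
    by (simp add: sum_distrib_left algebra_simps)
  also have "\<dots> \<le> l1norm {..<K} v * \<pi> j"
    unfolding Pi_eq[OF assms] row_prod_def
    by (intro mult_left_mono sum_mono Tmin_le l1norm_nonneg) (use A_nonneg assms in auto)
  finally show ?thesis .
qed

lemma row_prod_eq_0: "j < p \<Longrightarrow> \<pi> j = 0 \<Longrightarrow> row_prod K A v j = 0"
  using Tmin_abs_row_prod_le[of j v] Tmin_pos by (simp add: mult_le_0_iff)

lemma Pi_mult_ratio: "j < p \<Longrightarrow> \<pi> j * ratio v j = row_prod K A v j"
  using row_prod_eq_0[of j v] by (cases "\<pi> j = 0") (auto simp: ratio_def)

lemma abs_ratio_le:
  assumes "j < p"
  shows "\<bar>ratio v j\<bar> \<le> l1norm {..<K} v / \<tau>"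
proof (cases "\<pi> j = 0")
  case True
  then show ?thesis using Tmin_pos l1norm_nonneg[of "{..<K}" v] by (simp add: ratio_def)
next
  case False
  then have "0 < \<pi> j" using Pi_nonneg[of j] by simp
  then show ?thesis
    using Tmin_abs_row_prod_le[OF assms, of v] Tmin_pos by (simp add: ratio_def field_simps)
qed

lemma sum_row_prod: "(\<Sum>j<p. row_prod K A v j) = (\<Sum>k<K. v k)"
  unfolding row_prod_def
  by (subst sum.swap) (simp add: sum_distrib_right[symmetric] A_column)

text \<open>
  The norm of \<open>v\<close> given by the Fisher information matrix \<open>\<Sum>\<^sub>j A\<^sub>j A\<^sub>j\<^sup>T / \<pi>\<^sub>j\<close> at \<open>T\<close>.
\<close>

definition fisher_norm :: "(nat \<Rightarrow> real) \<Rightarrow> real" where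
  "fisher_norm v = sqrt (\<Sum>j<p. \<pi> j * (ratio v j)\<^sup>2)"

lemma fisher_norm_power2: "(fisher_norm v)\<^sup>2 = (\<Sum>j<p. \<pi> j * (ratio v j)\<^sup>2)"
  unfolding fisher_norm_def by (simp add: sum_nonneg Pi_nonneg)

lemma fisher_norm_nonneg: "0 \<le> fisher_norm v"
  unfolding fisher_norm_def by (simp add: sum_nonneg Pi_nonneg)

lemma kappa_l1norm_le_fisher_norm:
  assumes "v \<in> Rvec K"
  shows "\<kappa> * l1norm {..<K} v \<le> fisher_norm v"
proof -
  have "\<kappa> * l1norm {..<K} v \<le> l1norm (J_upper p \<pi>) (row_prod K A v)"
    by (rule kappa_mult_l1norm_le[OF assms])
  also have "\<dots> \<le> (\<Sum>j<p. \<bar>row_prod K A v j\<bar>)"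
    unfolding l1norm_def by (intro sum_mono2) (auto simp: J_upper_def)
  also have "\<dots> = (\<Sum>j<p. \<bar>sqrt (\<pi> j)\<bar> * \<bar>sqrt (\<pi> j) * ratio v j\<bar>)"
    by (intro sum.cong refl) (simp add: Pi_mult_ratio[symmetric] abs_mult Pi_nonneg mult.assoc[symmetric])
  also have "\<dots> \<le> L2_set (\<lambda>j. sqrt (\<pi> j)) {..<p} * L2_set (\<lambda>j. sqrt (\<pi> j) * ratio v j) {..<p}"
    by (rule L2_set_mult_ineq)
  also have "\<dots> = fisher_norm v"
    by (simp add: L2_set_def fisher_norm_def Pi_nonneg Pi_sum power_mult_distrib)
  finally show ?thesis .
qed

lemma abs_ratio_le_fisher_norm:
  assumes "j < p" "v \<in> Rvec K"
  shows "\<bar>ratio v j\<bar> \<le> fisher_norm v / (\<kappa> * \<tau>)"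
proof -
  have "\<bar>ratio v j\<bar> \<le> l1norm {..<K} v / \<tau>" by (rule abs_ratio_le[OF assms(1)])
  also have "\<dots> = (\<kappa> * l1norm {..<K} v) / (\<kappa> * \<tau>)" using kappa_pos by simp
  also have "\<dots> \<le> fisher_norm v / (\<kappa> * \<tau>)"
    using kappa_pos Tmin_pos by (intro divide_right_mono kappa_l1norm_le_fisher_norm assms) simp
  finally show ?thesis .
qed

lemma kappa_le_1: "\<kappa> \<le> 1"
proof -
  have "\<kappa> * 1 \<le> l1norm (J_upper p \<pi>) (row_prod K A (unit_vec 0))"
    using kappa_mult_l1norm_le[of "unit_vec 0" K A] K by (simp add: unit_vec_simps)
  also have "\<dots> \<le> (\<Sum>j<p. \<bar>A j 0\<bar>)"
    unfolding l1norm_def using K by (subst unit_vec_simps(2)) (auto intro!: sum_mono2 simp: J_upper_def)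
  also have "\<dots> = 1"
    using A_column[of 0] A_nonneg[of 0] K by simp
  finally show ?thesis by simp
qed

lemma K_le_leverage_bound: "K \<le> leverage_bound" and leverage_bound_ge_1: "1 \<le> leverage_bound"
proof -
  have "(\<kappa> * \<tau>)\<^sup>2 = \<kappa> * \<kappa> * \<tau> * \<tau>" by (simp add: power2_eq_square)
  also have "\<dots> \<le> 1 * 1 * 1 * \<tau>"
    using kappa_le_1 kappa_pos Tmin_le_1 Tmin_pos by (intro mult_mono) auto
  finally have "(\<kappa> * \<tau>)\<^sup>2 \<le> \<tau>" by simp
  then have "K * (\<kappa> * \<tau>)\<^sup>2 \<le> K * \<tau>" by (intro mult_left_mono) auto
  then show 1: "K \<le> leverage_bound"
    using K_Tmin_le kappa_pos Tmin_pos by (simp add: field_simps)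
  show "1 \<le> leverage_bound" using 1 K by linarith
qed

text \<open>
  The directions tangent to the simplex. On them \<open>ratio v\<close> has mean zero under \<open>\<pi>\<close>, since the columns
  of \<open>A\<close> sum to \<open>1\<close>.
\<close>

definition contrasts :: "(nat \<Rightarrow> real) set" where
  "contrasts = {v \<in> Rvec K. (\<Sum>k<K. v k) = 0}"

text \<open>
  Gram--Schmidt applied to the directions \<open>e\<^sub>k - T\<close>, which span the contrasts. The bound on
  \<open>s = \<Sum>\<^sub>a f\<^sub>a(j)\<^sup>2\<close> is self-improving: the function \<open>\<Sum>\<^sub>a f\<^sub>a(j) f\<^sub>a\<close> is again a ratio, has squared norm
  \<open>s\<close> and takes the value \<open>s\<close> at \<open>j\<close>, so the pointwise bound on ratios yields \<open>s \<le> \<surd>(s B)\<close>.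
\<close>

lemma orthonormal_ratios_exist:
  obtains m and f :: "nat \<Rightarrow> nat \<Rightarrow> real" where
    "m \<le> K"
    "\<And>a b. a < m \<Longrightarrow> b < m \<Longrightarrow> (\<Sum>j<p. \<pi> j * (f a j * f b j)) = of_bool (a = b)"
    "\<And>a. a < m \<Longrightarrow> (\<Sum>j<p. \<pi> j * f a j) = 0"
    "\<And>j. j < p \<Longrightarrow> (\<Sum>a<m. (f a j)\<^sup>2) \<le> leverage_bound"
    "\<And>v. v \<in> contrasts \<Longrightarrow>
      \<exists>c. \<forall>j<p. 0 < \<pi> j \<longrightarrow> ratio v j = (\<Sum>a<m. c a * f a j)"
proof -
  let ?W = "ratio ` contrasts"
  let ?e = "\<lambda>k i. unit_vec k i - T i"
  have T_R: "T \<in> Rvec K" "(\<Sum>k<K. T k) = 1" using T_simplex by (auto simp: prob_simplex_def)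
  have closed: "(\<lambda>j. c * f j + d * g j) \<in> ?W" if fg: "f \<in> ?W" "g \<in> ?W" for f g c d
  proof -
    obtain u v where uv: "u \<in> contrasts" "f = ratio u" "v \<in> contrasts" "g = ratio v"
      using fg by blast
    have "(\<lambda>k. c * u k + d * v k) \<in> contrasts"
      using uv by (simp add: contrasts_def Rvec_def sum.distrib sum_distrib_left[symmetric])
    moreover have "ratio (\<lambda>k. c * u k + d * v k) = (\<lambda>j. c * f j + d * g j)"
    proof
      fix j
      have "row_prod K A (\<lambda>k. c * u k + d * v k) j = c * row_prod K A u j + d * row_prod K A v j"
        by (simp add: row_prod_def sum.distrib sum_distrib_left algebra_simps)
      then show "ratio (\<lambda>k. c * u k + d * v k) j = c * f j + d * g j"
        by (simp add: uv ratio_def add_divide_distrib)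
    qed
    ultimately show ?thesis by (intro image_eqI) (rule sym)
  qed
  have e: "?e k \<in> contrasts" if "k < K" for k
    using that T_R unit_vec_simps[OF that]
    by (simp add: contrasts_def Rvec_def sum_subtractf)
  have "\<exists>m f. m \<le> K \<and> (\<forall>a<m. f a \<in> ?W) \<and>
    (\<forall>a<m. \<forall>b<m. (\<Sum>j<p. \<pi> j * (f a j * f b j)) = of_bool (a = b)) \<and>
    (\<forall>k<K. \<exists>c. \<forall>j\<in>{..<p}. \<pi> j > 0 \<longrightarrow> ratio (?e k) j = (\<Sum>a<m. c a * f a j))"
    by (rule orthonormal_family_exists[OF _ _ _ closed]) (use Pi_nonneg e in auto)
  then obtain m f where m: "m \<le> K" and fW: "\<And>a. a < m \<Longrightarrow> f a \<in> ?W"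
    and orth: "\<And>a b. a < m \<Longrightarrow> b < m \<Longrightarrow> (\<Sum>j<p. \<pi> j * (f a j * f b j)) = of_bool (a = b)"
    and span: "\<And>k. k < K \<Longrightarrow>
      \<exists>c. \<forall>j\<in>{..<p}. \<pi> j > 0 \<longrightarrow> ratio (?e k) j = (\<Sum>a<m. c a * f a j)"
    by blast
  show thesis
  proof (rule that[OF m orth])
    fix a assume "a < m"
    then obtain v where v: "v \<in> contrasts" "f a = ratio v" using fW by blast
    then show "(\<Sum>j<p. \<pi> j * f a j) = 0"
      using sum_row_prod[of v] by (simp add: Pi_mult_ratio contrasts_def)
  next
    fix j assume j: "j < p"
    let ?s = "\<Sum>a<m. (f a j)\<^sup>2"
    have "?e 0 \<in> contrasts" using e K by simp
    then have "ratio (?e 0) \<in> ?W" by blast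
    from closed[OF this this, of 0 0] have "(\<lambda>_. 0) \<in> ?W" by simp
    then have "(\<lambda>i. 0 + (\<Sum>a<m. f a j * f a i)) \<in> ?W"
      by (intro linear_combination_closed closed fW) auto
    then obtain v where v: "v \<in> contrasts" "\<And>i. ratio v i = (\<Sum>a<m. f a j * f a i)"
      by (auto simp: fun_eq_iff)
    have s: "ratio v j = ?s" by (simp add: v power2_eq_square)
    have "(fisher_norm v)\<^sup>2 = (\<Sum>i<p. \<Sum>a<m. \<Sum>b<m. f a j * f b j * (\<pi> i * (f a i * f b i)))"
      unfolding fisher_norm_power2 v(2) power2_eq_square[of "sum _ _"] sum_product
      by (simp add: sum_distrib_left algebra_simps)
    also have "\<dots> = (\<Sum>a<m. \<Sum>b<m. f a j * f b j * (\<Sum>i<p. \<pi> i * (f a i * f b i)))"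
      unfolding sum_distrib_left by (subst sum.swap) (intro sum.cong refl sum.swap)
    also have "\<dots> = ?s"
      by (simp add: orth of_bool_def if_distrib power2_eq_square cong: if_cong)
    finally have n: "(fisher_norm v)\<^sup>2 = ?s" .
    have s0: "0 \<le> ?s" by (simp add: sum_nonneg)
    have "?s \<le> fisher_norm v / (\<kappa> * \<tau>)"
      using abs_ratio_le_fisher_norm[OF j, of v] v(1) by (simp add: s contrasts_def)
    then have "?s\<^sup>2 \<le> (fisher_norm v / (\<kappa> * \<tau>))\<^sup>2"
      using s0 by (intro power_mono)
    also have "\<dots> = ?s * leverage_bound" by (simp add: power_divide n)
    finally have "?s * ?s \<le> ?s * leverage_bound" by (simp add: power2_eq_square)
    then show "?s \<le> leverage_bound"
    proof (cases "?s = 0")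
      case False
      with s0 have "0 < ?s" by simp
      with \<open>?s * ?s \<le> ?s * leverage_bound\<close> show ?thesis by (rule mult_left_le_imp_le)
    qed (use leverage_bound_ge_1 in simp)
  next
    fix v assume v: "v \<in> contrasts"
    define c where "c k = (SOME c. \<forall>j\<in>{..<p}. \<pi> j > 0 \<longrightarrow> ratio (?e k) j = (\<Sum>a<m. c a * f a j))" for k
    have c: "ratio (?e k) j = (\<Sum>a<m. c k a * f a j)" if "k < K" "j < p" "\<pi> j > 0" for k j
      using someI_ex[OF span[OF that(1)]] that unfolding c_def by blast
    show "\<exists>c. \<forall>j<p. 0 < \<pi> j \<longrightarrow> ratio v j = (\<Sum>a<m. c a * f a j)"
    proof (intro exI allI impI)
      fix j assume j: "j < p" "0 < \<pi> j"
      have e_row: "row_prod K A (?e k) j = A j k - \<pi> j" if "k < K" for k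
        using unit_vec_simps(2)[OF that, of A j] j
        by (simp add: row_prod_def right_diff_distrib sum_subtractf Pi_eq)
      have "(\<Sum>k<K. v k * row_prod K A (?e k) j) = (\<Sum>k<K. v k * (A j k - \<pi> j))"
        by (simp add: e_row)
      also have "\<dots> = row_prod K A v j - (\<Sum>k<K. v k) * \<pi> j"
        by (simp add: row_prod_def right_diff_distrib sum_subtractf sum_distrib_right mult.commute)
      finally have "(\<Sum>k<K. v k * row_prod K A (?e k) j) = row_prod K A v j - (\<Sum>k<K. v k) * \<pi> j" .
      then have "row_prod K A v j = (\<Sum>k<K. v k * row_prod K A (?e k) j)"
        using v by (simp add: contrasts_def)
      then have "ratio v j = (\<Sum>k<K. v k * ratio (?e k) j)"
        by (simp add: ratio_def sum_divide_distrib)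
      also have "\<dots> = (\<Sum>k<K. v k * (\<Sum>a<m. c k a * f a j))"
        by (simp add: c j)
      also have "\<dots> = (\<Sum>a<m. (\<Sum>k<K. v k * c k a) * f a j)"
        unfolding sum_distrib_left sum_distrib_right by (subst sum.swap) (simp add: mult.assoc)
      finally show "ratio v j = (\<Sum>a<m. (\<Sum>k<K. v k * c k a) * f a j)" .
    qed
  qed
qed

section \<open>Fluctuations of the sample\<close>

lemma set_pmf_q: "set_pmf q = {j. j < p \<and> 0 < \<pi> j}"
proof -
  have "\<pi> j = 0" if "\<not> j < p" for j
    using that by (simp add: mat_vec_def)
  then have *: "\<pi> j \<noteq> 0 \<longleftrightarrow> j < p \<and> 0 < \<pi> j" for j
    using Pi_nonneg[of j] by (cases "j < p") auto
  show ?thesis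
    by (rule set_eqI) (simp only: set_pmf_iff pmf_categorical_pmf[OF Pi_simplex] mem_Collect_eq *)
qed

lemma finite_set_pmf_q: "finite (set_pmf q)"
  by (simp add: set_pmf_q)

lemma expectation_q: "measure_pmf.expectation q g = (\<Sum>j<p. \<pi> j * g j)" for g :: "nat \<Rightarrow> real"
  by (subst integral_measure_pmf[of "{..<p}"]) (auto simp: set_pmf_q pmf_categorical_pmf[OF Pi_simplex])

text \<open>
  The fourth moment of \<open>\<parallel>f\<parallel>\<close> is at most \<open>B E \<parallel>f\<parallel>\<^sup>2 = B m\<close>; with \<open>B \<le> N\<close> its contribution to the variance of
  the squared length is of the same order \<open>K N\<^sup>2\<close> as the main term.
\<close>

lemma prob_linear_fluctuation_ge:
  fixes f :: "nat \<Rightarrow> nat \<Rightarrow> real"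
  assumes m: "m \<le> K"
    and orth: "\<And>a b. a < m \<Longrightarrow> b < m \<Longrightarrow> (\<Sum>j<p. \<pi> j * (f a j * f b j)) = of_bool (a = b)"
    and centred: "\<And>a. a < m \<Longrightarrow> (\<Sum>j<p. \<pi> j * f a j) = 0"
    and lev: "\<And>j. j < p \<Longrightarrow> (\<Sum>a<m. (f a j)\<^sup>2) \<le> leverage_bound"
    and N: "leverage_bound \<le> real N"
  shows "measure_pmf.prob (replicate_pmf N q)
      {xs. 4 * K * N \<le> (L2_set (sample_sum (\<lambda>j a. f a j) xs) {..<m})\<^sup>2} \<le> 1 / K"
proof -
  let ?X = "\<lambda>j a. f a j"
  let ?B = "leverage_bound"
  have N0: "0 < real N" using N leverage_bound_ge_1 by linarith
  have K0: "0 < real K" using K by simp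
  have orth': "measure_pmf.expectation q (\<lambda>j. ?X j a * ?X j b) = of_bool (a = b)"
    if "a \<in> {..<m}" "b \<in> {..<m}" for a b
    using that by (simp add: expectation_q orth)
  have centred': "measure_pmf.expectation q (\<lambda>j. ?X j a) = 0" if "a \<in> {..<m}" for a
    using that by (simp add: expectation_q centred)
  note facts = finite_set_pmf_q finite_lessThan[of m] centred' orth'
  have M4: "measure_pmf.expectation q (\<lambda>j. (L2_set (?X j) {..<m}) ^ 4) \<le> ?B * K"
  proof -
    have "measure_pmf.expectation q (\<lambda>j. (L2_set (?X j) {..<m}) ^ 4)
        \<le> measure_pmf.expectation q (\<lambda>j. ?B * (L2_set (?X j) {..<m})\<^sup>2)"
      unfolding expectation_q
    proof (intro sum_mono mult_left_mono Pi_nonneg)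
      fix j assume "j \<in> {..<p}"
      then have "(L2_set (?X j) {..<m})\<^sup>2 * (L2_set (?X j) {..<m})\<^sup>2 \<le> ?B * (L2_set (?X j) {..<m})\<^sup>2"
        by (intro mult_right_mono) (simp_all add: L2_set_power2 lev sum_nonneg)
      then show "(L2_set (?X j) {..<m}) ^ 4 \<le> ?B * (L2_set (?X j) {..<m})\<^sup>2"
        by (simp add: power2_eq_square power4_eq_xxxx mult.assoc)
    qed
    also have "\<dots> = ?B * m"
      using expectation_L2_set_power2_isotropic[OF facts] by simp
    also have "\<dots> \<le> ?B * K" using m by (intro mult_left_mono) auto
    finally show ?thesis .
  qed
  have "measure_pmf.prob (replicate_pmf N q) {xs. 4 * K * N \<le> (L2_set (sample_sum ?X xs) {..<m})\<^sup>2}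
      \<le> measure_pmf.prob (replicate_pmf N q)
        {xs. real N * card {..<m} + 3 * real K * real N \<le> (L2_set (sample_sum ?X xs) {..<m})\<^sup>2}"
  proof (intro measure_pmf.finite_measure_mono)
    have "real N * m \<le> real N * K" using m by (intro mult_left_mono) auto
    then show "{xs. 4 * K * N \<le> (L2_set (sample_sum ?X xs) {..<m})\<^sup>2}
      \<subseteq> {xs. real N * card {..<m} + 3 * real K * real N \<le> (L2_set (sample_sum ?X xs) {..<m})\<^sup>2}"
      by (auto simp: algebra_simps)
  qed auto
  also have "\<dots> \<le> (2 * card {..<m} * (real N)\<^sup>2 + N * (?B * K)) / (3 * real K * real N)\<^sup>2"
    using N0 K0 by (intro prob_L2_set_sample_sum_power2_ge[OF facts M4]) auto
  also have "\<dots> \<le> (2 * K * (real N)\<^sup>2 + N * (N * K)) / (3 * real K * real N)\<^sup>2"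
  proof -
    have "real N * (?B * K) \<le> N * (real N * K)"
      by (intro mult_left_mono mult_right_mono N) auto
    then show ?thesis
      using m by (intro divide_right_mono add_mono mult_right_mono) auto
  qed
  also have "\<dots> = 1 / (3 * K)"
    using N0 K0 by (simp add: field_simps power2_eq_square)
  also have "\<dots> \<le> 1 / K" using K0 by (simp add: field_simps)
  finally show ?thesis .
qed

text \<open>
  With \<open>s = \<Sum>\<^sub>a f\<^sub>a\<^sup>2 \<le> B\<close>, the squared Frobenius norm of \<open>f f\<^sup>T - I\<close> is \<open>s\<^sup>2 - 2 s + m\<close>: at most \<open>(2 B)\<^sup>2\<close>
  pointwise, and at most \<open>B K\<close> on average. The exponential inequality is used with the parameter
  \<open>l = 1 / (4 B K)\<close>, which minimises its exponent.
\<close>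

lemma prob_quadratic_fluctuation_ge:
  fixes f :: "nat \<Rightarrow> nat \<Rightarrow> real"
  assumes m: "m \<le> K"
    and orth: "\<And>a b. a < m \<Longrightarrow> b < m \<Longrightarrow> (\<Sum>j<p. \<pi> j * (f a j * f b j)) = of_bool (a = b)"
    and lev: "\<And>j. j < p \<Longrightarrow> (\<Sum>a<m. (f a j)\<^sup>2) \<le> leverage_bound"
    and N: "16 * leverage_bound * K * ln K \<le> real N"
  shows "measure_pmf.prob (replicate_pmf N q)
      {xs. N / 2 \<le> L2_set (sample_sum (\<lambda>j (a, b). f a j * f b j - of_bool (a = b)) xs)
        ({..<m} \<times> {..<m})} \<le> 2 / K"
proof -
  let ?X = "\<lambda>j (a, b). f a j * f b j - of_bool (a = b)"
  let ?I = "{..<m} \<times> {..<m}"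
  let ?B = "leverage_bound"
  let ?s = "\<lambda>j. \<Sum>a<m. (f a j)\<^sup>2"
  have B: "0 < ?B" "1 \<le> ?B" "real m \<le> ?B"
    using leverage_bound_ge_1 K_le_leverage_bound m by auto
  have K0: "0 < real K" using K by simp
  have L2: "(L2_set (?X j) ?I)\<^sup>2 = (?s j)\<^sup>2 - 2 * ?s j + m" for j
  proof -
    have "(L2_set (?X j) ?I)\<^sup>2 = (\<Sum>a<m. \<Sum>b<m. (f a j * f b j - of_bool (a = b))\<^sup>2)"
      unfolding L2_set_power2 by (simp add: sum.cartesian_product case_prod_unfold)
    also have "\<dots> = (\<Sum>a<m. \<Sum>b<m. (f a j)\<^sup>2 * (f b j)\<^sup>2
        - 2 * (f a j * f b j * of_bool (a = b)) + of_bool (a = b))"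
    proof (intro sum.cong refl)
      fix a b
      show "(f a j * f b j - of_bool (a = b))\<^sup>2 = (f a j)\<^sup>2 * (f b j)\<^sup>2
        - 2 * (f a j * f b j * of_bool (a = b)) + of_bool (a = b)"
        by (cases "a = b") (simp_all add: power2_diff power_mult_distrib)
    qed
    also have "\<dots> = (\<Sum>a<m. \<Sum>b<m. (f a j)\<^sup>2 * (f b j)\<^sup>2)
        - (\<Sum>a<m. \<Sum>b<m. 2 * (f a j * f b j * of_bool (a = b))) + (\<Sum>a<m. \<Sum>b<m. of_bool (a = b))"
      by (simp only: sum.distrib sum_subtractf)
    also have "(\<Sum>a<m. \<Sum>b<m. (f a j)\<^sup>2 * (f b j)\<^sup>2) = (?s j)\<^sup>2"
      by (simp add: sum_product power2_eq_square[of "sum _ _"])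
    also have "(\<Sum>a<m. \<Sum>b<m. 2 * (f a j * f b j * of_bool (a = b))) = 2 * ?s j"
      by (simp add: sum_distrib_left of_bool_def if_distrib power2_eq_square cong: if_cong)
    also have "(\<Sum>a<m. \<Sum>b<m. of_bool (a = b)) = real m"
      by (simp add: of_bool_def)
    finally show ?thesis .
  qed
  have Es: "(\<Sum>j<p. \<pi> j * ?s j) = m"
  proof -
    have "(\<Sum>j<p. \<pi> j * ?s j) = (\<Sum>a<m. \<Sum>j<p. \<pi> j * (f a j * f a j))"
      unfolding sum_distrib_left by (subst sum.swap) (simp add: power2_eq_square)
    also have "\<dots> = m" by (simp add: orth)
    finally show ?thesis .
  qed
  have s0: "0 \<le> ?s j" for j by (simp add: sum_nonneg)
  have var: "measure_pmf.expectation q (\<lambda>j. (L2_set (?X j) ?I)\<^sup>2) \<le> ?B * K"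
  proof -
    have "measure_pmf.expectation q (\<lambda>j. (L2_set (?X j) ?I)\<^sup>2)
        \<le> (\<Sum>j<p. ?B * (\<pi> j * ?s j) - 2 * (\<pi> j * ?s j) + m * \<pi> j)"
      unfolding expectation_q L2
    proof (rule sum_mono)
      fix j assume "j \<in> {..<p}"
      then have "?s j * ?s j \<le> ?B * ?s j" by (intro mult_right_mono lev s0) auto
      then have "(?s j)\<^sup>2 - 2 * ?s j + m \<le> ?B * ?s j - 2 * ?s j + m"
        by (simp add: power2_eq_square[of "sum _ _"])
      from mult_left_mono[OF this Pi_nonneg[of j]]
      show "\<pi> j * ((?s j)\<^sup>2 - 2 * ?s j + m) \<le> ?B * (\<pi> j * ?s j) - 2 * (\<pi> j * ?s j) + m * \<pi> j"
        by (simp only: algebra_simps)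
    qed
    also have "\<dots> = ?B * m - 2 * m + m"
      by (simp only: sum.distrib sum_subtractf sum_distrib_left[symmetric] Es Pi_sum mult_1_right)
    also have "\<dots> \<le> ?B * m" by simp
    also have "\<dots> \<le> ?B * K" using m B by (intro mult_left_mono) auto
    finally show ?thesis .
  qed
  have arith: "1 / (4 * y * k) * L \<le> 1"
    if L: "L\<^sup>2 = s\<^sup>2 - 2 * s + m" and s: "0 \<le> s" "s \<le> y" and y: "m \<le> y" "1 \<le> y" and k: "1 \<le> k"
    for L s m y k :: real
  proof -
    have "s\<^sup>2 \<le> y\<^sup>2" using s by (intro power_mono)
    moreover have "m \<le> y\<^sup>2" using y self_le_power[of y 2] by simp
    moreover have "0 \<le> y\<^sup>2" by simp
    moreover have "(2 * y)\<^sup>2 = 4 * y\<^sup>2" by (simp add: power_mult_distrib)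
    ultimately have "L\<^sup>2 \<le> (2 * y)\<^sup>2" using L s by linarith
    then have "L \<le> 2 * y" by (rule power2_le_imp_le) (use y in simp)
    moreover have "2 * y * 1 \<le> 2 * y * (2 * k)" using y k by (intro mult_left_mono) auto
    moreover have "2 * y * (2 * k) = 4 * y * k" by simp
    ultimately have "L \<le> 4 * y * k" by linarith
    moreover have "0 < 4 * y * k" using y k by simp
    ultimately show ?thesis by (simp add: field_simps)
  qed
  have bound: "1 / (4 * ?B * K) * L2_set (?X j) ?I \<le> 1" if "j \<in> set_pmf q" for j
  proof (rule arith[OF L2 s0])
    show "?s j \<le> ?B" using that by (intro lev) (simp add: set_pmf_q)
    show "1 \<le> real K" using K by simp
  qed (fact B)+
  have "measure_pmf.prob (replicate_pmf N q) {xs. N / 2 \<le> L2_set (sample_sum ?X xs) ?I}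
      \<le> 2 * exp (real N * ((1 / (4 * ?B * K))\<^sup>2 * (?B * K)) - 1 / (4 * ?B * K) * (N / 2))"
    by (rule prob_L2_set_sample_sum_ge[OF finite_set_pmf_q _ var _ bound])
       (use B K0 Pi_sum in \<open>auto simp: expectation_q right_diff_distrib sum_subtractf orth
          sum_distrib_right[symmetric]\<close>)
  also have "real N * ((1 / (4 * ?B * K))\<^sup>2 * (?B * K)) - 1 / (4 * ?B * K) * (N / 2)
      = - (N / (16 * ?B * K))"
  proof -
    define y where "y = ?B * K"
    have "0 < y" using B K0 by (simp add: y_def)
    then have "real N * ((1 / (4 * y))\<^sup>2 * y) - 1 / (4 * y) * (N / 2) = - (N / (16 * y))"
      by (simp add: field_simps power2_eq_square)
    then show ?thesis by (simp only: y_def mult.assoc)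
  qed
  also have "2 * exp (- (N / (16 * ?B * K))) \<le> 2 * exp (- ln K)"
  proof -
    have "16 * ?B * K > 0" using B K0 by simp
    then have "ln K \<le> N / (16 * ?B * K)"
      using N by (simp only: pos_le_divide_eq) (simp only: mult_ac)
    then show ?thesis by simp
  qed
  also have "\<dots> = 2 / K" using K0 by (simp add: exp_minus inverse_eq_divide)
  finally show ?thesis .
qed

section \<open>The maximum likelihood estimator\<close>

text \<open>
  The likelihood at the true parameter is positive, so the maximiser cannot give probability zero to
  an observed cell, and the comparison of extended real likelihoods becomes one of real sums.
\<close>

lemma mle_sum_ln_ratio_nonneg:
  assumes xs: "set xs \<subseteq> set_pmf q" and N: "length xs = N" "0 < N"
    and mle: "is_mle p K A (\<lambda>j. real (count_list xs j) / real N) T'"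
  shows "\<And>j. j \<in> set xs \<Longrightarrow> 0 < 1 + ratio (\<lambda>k. T' k - T k) j"
    and "0 \<le> (\<Sum>j\<leftarrow>xs. ln (1 + ratio (\<lambda>k. T' k - T k) j))"
    and "(\<lambda>k. T' k - T k) \<in> contrasts"
proof -
  let ?X = "\<lambda>j. real (count_list xs j) / real N"
  let ?v = "\<lambda>k. T' k - T k"
  have xs_p: "j < p" "0 < \<pi> j" if "j \<in> set xs" for j
    using that xs set_pmf_q by auto
  have T': "T' \<in> prob_simplex K" and max: "\<not> loglik p K A ?X T' < loglik p K A ?X T"
    using mle T_simplex by (auto simp: is_mle_def is_arg_max_def)
  have J: "{j. j < p \<and> ?X j > 0} = set xs"
  proof -
    have "0 < count_list xs j \<longleftrightarrow> j \<in> set xs" for j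
      by (metis count_list_0_iff not_gr_zero)
    then show ?thesis using xs_p N by (auto simp: zero_less_divide_iff)
  qed
  have ll: "loglik p K A ?X S = (\<Sum>j\<in>set xs. ereal (?X j) * ext_ln (row_prod K A S j))" for S
    unfolding loglik_def J ..
  have Xpos: "0 < ?X j" if "j \<in> set xs" for j
    using that J by blast
  have fin: "loglik p K A ?X S = ereal (\<Sum>j\<in>set xs. ?X j * ln (row_prod K A S j))"
    if "\<And>j. j \<in> set xs \<Longrightarrow> 0 < row_prod K A S j" for S
    unfolding ll using that by (simp add: ext_ln_def)
  have T_pos: "0 < row_prod K A T j" if "j \<in> set xs" for j
    using xs_p[OF that] by (simp add: Pi_eq)
  have T'_pos: "0 < row_prod K A T' j" if j: "j \<in> set xs" for j
  proof (rule ccontr)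
    assume "\<not> ?thesis"
    have minf: "ereal x * - \<infinity> = - \<infinity>" if "0 < x" for x :: real
      using that by simp
    from \<open>\<not> ?thesis\<close> have "ext_ln (row_prod K A T' j) = -\<infinity>"
      by (simp add: ext_ln_def)
    then have "ereal (?X j) * ext_ln (row_prod K A T' j) = -\<infinity>"
      using minf[OF Xpos[OF j]] by (simp only:)
    moreover have "(\<Sum>i\<in>set xs - {j}. ereal (?X i) * ext_ln (row_prod K A T' i)) \<noteq> \<infinity>"
    proof -
      have "ereal x * ext_ln y \<noteq> \<infinity>" if "0 < x" for x y
        using that by (simp add: ext_ln_def)
      then show ?thesis using Xpos by (simp only: sum_Pinfty) blast
    qed
    ultimately have "loglik p K A ?X T' = -\<infinity>"
      unfolding ll using j by (subst sum.remove[of _ j]) auto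
    then show False using max fin[OF T_pos] by simp
  qed
  have one: "1 + ratio ?v j = row_prod K A T' j / \<pi> j" if "j \<in> set xs" for j
    using xs_p[OF that]
    by (simp add: ratio_def Pi_eq row_prod_def right_diff_distrib sum_subtractf diff_divide_distrib)
  show pos: "\<And>j. j \<in> set xs \<Longrightarrow> 0 < 1 + ratio ?v j"
    using T'_pos xs_p by (simp add: one)
  have "0 \<le> (\<Sum>j\<in>set xs. ?X j * ln (row_prod K A T' j)) - (\<Sum>j\<in>set xs. ?X j * ln (row_prod K A T j))"
    using max by (simp add: fin T'_pos T_pos not_less)
  also have "\<dots> = (\<Sum>j\<in>set xs. ?X j * ln (1 + ratio ?v j))"
  proof -
    have "ln (1 + ratio ?v j) = ln (row_prod K A T' j) - ln (row_prod K A T j)"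
      if "j \<in> set xs" for j
      using T'_pos[OF that] T_pos[OF that] by (simp add: one[OF that] Pi_eq xs_p[OF that] ln_div)
    then show ?thesis by (simp add: sum_subtractf right_diff_distrib diff_divide_distrib)
  qed
  also have "\<dots> = (\<Sum>j\<leftarrow>xs. ln (1 + ratio ?v j)) / N"
    by (simp add: sum_list_map_count sum_divide_distrib)
  finally show "0 \<le> (\<Sum>j\<leftarrow>xs. ln (1 + ratio ?v j))"
    using N by (simp add: zero_le_divide_iff)
  show "?v \<in> contrasts"
    using T' T_simplex by (simp add: contrasts_def prob_simplex_def Rvec_def sum_subtractf)
qed

text \<open>
  The deterministic part of the argument, on the event that both fluctuations are small. Here \<open>\<rho>\<close>
  is both the Fisher norm of the error and the Euclidean norm of its coefficients \<open>c\<close>. The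
  inequality obtained for every admissible \<open>t\<close> excludes \<open>\<rho> > \<kappa> \<tau>\<close>, after which \<open>t = 1\<close> is
  admissible.
\<close>

lemma mle_l1norm_le:
  fixes f :: "nat \<Rightarrow> nat \<Rightarrow> real"
  assumes orth: "\<And>a b. a < m \<Longrightarrow> b < m \<Longrightarrow> (\<Sum>j<p. \<pi> j * (f a j * f b j)) = of_bool (a = b)"
    and span: "\<And>v. v \<in> contrasts \<Longrightarrow>
      \<exists>c. \<forall>j<p. 0 < \<pi> j \<longrightarrow> ratio v j = (\<Sum>a<m. c a * f a j)"
    and xs: "set xs \<subseteq> set_pmf q" and N: "length xs = N" "0 < N"
    and mle: "is_mle p K A (\<lambda>j. real (count_list xs j) / real N) T'"
    and lin: "(L2_set (sample_sum (\<lambda>j a. f a j) xs) {..<m})\<^sup>2 \<le> 4 * K * N"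
    and quad: "L2_set (sample_sum (\<lambda>j (a, b). f a j * f b j - of_bool (a = b)) xs)
        ({..<m} \<times> {..<m}) \<le> N / 2"
    and large: "1024 * leverage_bound * K < N"
  shows "l1norm {..<K} (\<lambda>k. T' k - T k) \<le> 32 * inverse \<kappa> * sqrt (K / N)"
proof -
  let ?v = "\<lambda>k. T' k - T k"
  let ?S = "sample_sum (\<lambda>j a. f a j) xs"
  let ?S2 = "sample_sum (\<lambda>j (a, b). f a j * f b j - of_bool (a = b)) xs"
  let ?I = "{..<m} \<times> {..<m}"
  note mle_facts = mle_sum_ln_ratio_nonneg[OF xs N mle]
  have v: "?v \<in> contrasts" by (rule mle_facts)
  then have vR: "?v \<in> Rvec K" by (simp add: contrasts_def)
  obtain c where c: "\<And>j. j < p \<Longrightarrow> 0 < \<pi> j \<Longrightarrow> ratio ?v j = (\<Sum>a<m. c a * f a j)"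
    using span[OF v] by blast
  have xs_p: "j < p" "0 < \<pi> j" if "j \<in> set xs" for j
    using that xs set_pmf_q by auto
  define \<rho> where "\<rho> = fisher_norm ?v"
  have \<rho>0: "0 \<le> \<rho>" by (simp add: \<rho>_def fisher_norm_nonneg)
  have sq: "(\<Sum>a<m. c a * f a j)\<^sup>2 = (\<Sum>a<m. \<Sum>b<m. c a * c b * (f a j * f b j))" for j
    by (simp add: power2_eq_square sum_product algebra_simps)
  have \<rho>c: "\<rho> = L2_set c {..<m}"
  proof -
    have "\<rho>\<^sup>2 = (\<Sum>j<p. \<pi> j * (\<Sum>a<m. c a * f a j)\<^sup>2)"
      unfolding \<rho>_def fisher_norm_power2
    proof (intro sum.cong refl)
      fix j assume "j \<in> {..<p}"
      then show "\<pi> j * (ratio ?v j)\<^sup>2 = \<pi> j * (\<Sum>a<m. c a * f a j)\<^sup>2"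
        using c[of j] Pi_nonneg[of j] by (cases "\<pi> j = 0") auto
    qed
    also have "\<dots> = (\<Sum>j<p. \<Sum>a<m. \<Sum>b<m. c a * c b * (\<pi> j * (f a j * f b j)))"
      unfolding sq by (simp add: sum_distrib_left algebra_simps)
    also have "\<dots> = (\<Sum>a<m. \<Sum>b<m. c a * c b * (\<Sum>j<p. \<pi> j * (f a j * f b j)))"
      unfolding sum_distrib_left by (subst sum.swap) (intro sum.cong refl sum.swap)
    also have "\<dots> = (L2_set c {..<m})\<^sup>2"
      by (simp add: orth L2_set_power2 of_bool_def if_distrib power2_eq_square[of "c _"] cong: if_cong)
    finally show ?thesis using \<rho>0 by (simp add: power2_eq_iff_nonneg)
  qed
  have sum_h: "(\<Sum>j\<leftarrow>xs. ratio ?v j) = (\<Sum>a<m. c a * ?S a)"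
  proof -
    have "(\<Sum>j\<leftarrow>xs. ratio ?v j) = (\<Sum>j\<leftarrow>xs. \<Sum>a<m. c a * f a j)"
      by (intro arg_cong[of _ _ sum_list] map_cong refl c xs_p)
    also have "\<dots> = (\<Sum>a<m. c a * ?S a)"
      using sum_list_linear_combination[of 0] by simp
    finally show ?thesis .
  qed
  have sum_h2: "(\<Sum>j\<leftarrow>xs. (ratio ?v j)\<^sup>2)
      = N * \<rho>\<^sup>2 + (\<Sum>(a, b)\<in>?I. (c a * c b) * ?S2 (a, b))"
  proof -
    have "(\<Sum>j\<leftarrow>xs. (ratio ?v j)\<^sup>2) = (\<Sum>j\<leftarrow>xs. (\<Sum>a<m. c a * f a j)\<^sup>2)"
      by (intro arg_cong[of _ _ sum_list] map_cong refl) (simp add: c xs_p)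
    also have "\<dots> = (\<Sum>j\<leftarrow>xs. \<rho>\<^sup>2 + (\<Sum>(a, b)\<in>?I. (c a * c b) * (f a j * f b j - of_bool (a = b))))"
    proof (intro arg_cong[of _ _ sum_list] map_cong refl)
      fix j
      have "(\<Sum>a<m. \<Sum>b<m. c a * c b * of_bool (a = b)) = \<rho>\<^sup>2"
        by (simp add: \<rho>c L2_set_power2 of_bool_def if_distrib power2_eq_square[of "c _"] cong: if_cong)
      then show "(\<Sum>a<m. c a * f a j)\<^sup>2
          = \<rho>\<^sup>2 + (\<Sum>(a, b)\<in>?I. (c a * c b) * (f a j * f b j - of_bool (a = b)))"
        unfolding sq by (simp add: sum.cartesian_product[symmetric] right_diff_distrib sum_subtractf)
    qed
    also have "\<dots> = length xs * \<rho>\<^sup>2 + (\<Sum>(a, b)\<in>?I. (c a * c b) * ?S2 (a, b))"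
      using sum_list_linear_combination[where d = "\<lambda>(a, b). c a * c b" and r = "\<rho>\<^sup>2"
          and I = ?I and xs = xs and X = "\<lambda>j (a, b). f a j * f b j - of_bool (a = b)"]
      by (simp add: case_prod_unfold)
    finally show ?thesis using N by simp
  qed
  have lin': "(\<Sum>j\<leftarrow>xs. ratio ?v j) \<le> \<rho> * L2_set ?S {..<m}"
    unfolding sum_h \<rho>c using abs_sum_mult_le_L2_set[where s = c and v = ?S and I = "{..<m}"] by simp
  have "\<bar>\<Sum>(a, b)\<in>?I. (c a * c b) * ?S2 (a, b)\<bar> \<le> L2_set (\<lambda>(a, b). c a * c b) ?I * L2_set ?S2 ?I"
    using abs_sum_mult_le_L2_set[where s = "\<lambda>(a, b). c a * c b" and v = ?S2 and I = ?I]
    by (simp add: case_prod_unfold)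
  also have "L2_set (\<lambda>(a, b). c a * c b) ?I = \<rho>\<^sup>2"
  proof -
    have "(L2_set (\<lambda>(a, b). c a * c b) ?I)\<^sup>2 = (\<rho>\<^sup>2)\<^sup>2"
      unfolding \<rho>c L2_set_power2
      by (simp add: power2_eq_square[of "sum _ _"] sum_product sum.cartesian_product
          power_mult_distrib case_prod_unfold)
    then show ?thesis by (rule power2_eq_imp_eq) auto
  qed
  also have "\<rho>\<^sup>2 * L2_set ?S2 ?I \<le> \<rho>\<^sup>2 * (N / 2)"
    using quad by (intro mult_left_mono) auto
  finally have quad': "N * \<rho>\<^sup>2 / 2 \<le> (\<Sum>j\<leftarrow>xs. (ratio ?v j)\<^sup>2)"
    unfolding sum_h2 by (simp add: abs_le_iff field_simps)
  have kt: "0 < \<kappa> * \<tau>" using kappa_pos Tmin_pos by simp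
  have L2_lin: "L2_set ?S {..<m} \<le> 2 * sqrt (K * N)"
    using real_le_rsqrt[OF lin] by (simp add: real_sqrt_mult)
  have localised: "t * \<rho> \<le> 32 * sqrt (K / N)"
    if t: "0 < t" "t \<le> 1" "t * \<rho> \<le> \<kappa> * \<tau>" for t
  proof (cases "\<rho> = 0")
    case False
    then have \<rho>: "0 < \<rho>" using \<rho>0 by simp
    have th: "t * ratio ?v j \<le> 1" if "j \<in> set xs" for j
    proof -
      have "ratio ?v j \<le> \<rho> / (\<kappa> * \<tau>)"
        using abs_ratio_le_fisher_norm[OF xs_p(1)[OF that] vR] by (simp add: \<rho>_def)
      then have "t * ratio ?v j \<le> t * (\<rho> / (\<kappa> * \<tau>))" using t by (intro mult_left_mono) auto
      also have "\<dots> = (t * \<rho>) / (\<kappa> * \<tau>)" by simp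
      also have "\<dots> \<le> 1" using t kt by (simp only: divide_le_eq_1) simp
      finally show ?thesis .
    qed
    have "t * (N * \<rho>\<^sup>2 / 2) \<le> t * (\<Sum>j\<leftarrow>xs. (ratio ?v j)\<^sup>2)"
      using t quad' by (intro mult_left_mono) auto
    also have "\<dots> \<le> 8 * (\<Sum>j\<leftarrow>xs. ratio ?v j)"
      by (rule sum_power2_le_of_sum_ln_nonneg[OF mle_facts(1,2) t(1,2) th])
    also have "\<dots> \<le> 8 * (\<rho> * L2_set ?S {..<m})" using lin' by simp
    also have "\<dots> \<le> 8 * (\<rho> * (2 * sqrt (K * N)))"
      using L2_lin \<rho> by (intro mult_left_mono) auto
    finally have "\<rho> * (t * \<rho> * N) \<le> \<rho> * (32 * sqrt (K * N))"
      by (simp add: power2_eq_square algebra_simps)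
    then have "t * \<rho> * N \<le> 32 * sqrt (K * N)" using \<rho> by simp
    then have "t * \<rho> \<le> 32 * sqrt (K * N) / N" using N by (simp add: field_simps)
    also have "\<dots> = 32 * sqrt (K / N)"
      using N by (simp add: real_sqrt_mult real_sqrt_divide field_simps)
    finally show ?thesis .
  qed simp
  have small: "32 * sqrt (K / N) < \<kappa> * \<tau>"
  proof -
    have "1024 * K / N < (\<kappa> * \<tau>)\<^sup>2"
    proof -
      have "1024 * leverage_bound * K = 1024 * K / (\<kappa> * \<tau>)\<^sup>2" by simp
      with large have "1024 * K / (\<kappa> * \<tau>)\<^sup>2 < N" by linarith
      moreover have "0 < (\<kappa> * \<tau>)\<^sup>2" using kt by (rule zero_less_power)
      ultimately show ?thesis using N by (simp only: pos_divide_less_eq of_nat_0_less_iff) (simp add: mult.commute)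
    qed
    then have "(32 * sqrt (K / N))\<^sup>2 < (\<kappa> * \<tau>)\<^sup>2"
      by (simp add: power_mult_distrib)
    then show ?thesis using kt by (intro power2_less_imp_less[of _ "\<kappa> * \<tau>"]) auto
  qed
  \<comment> \<open>Otherwise shrink the error to the radius \<open>\<kappa> \<tau>\<close>, where the bound is violated.\<close>
  have "\<rho> \<le> \<kappa> * \<tau>"
  proof (rule ccontr)
    assume "\<not> ?thesis"
    then have gt: "\<kappa> * \<tau> < \<rho>" by simp
    then have "\<kappa> * \<tau> / \<rho> * \<rho> = \<kappa> * \<tau>" using kt by simp
    moreover have "\<kappa> * \<tau> / \<rho> * \<rho> \<le> 32 * sqrt (K / N)"
      using gt kt by (intro localised) auto
    ultimately show False using small by linarith
  qed
  then have "\<rho> \<le> 32 * sqrt (K / N)" using localised[of 1] by simp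
  then have "\<kappa> * l1norm {..<K} ?v \<le> 32 * sqrt (K / N)"
    using kappa_l1norm_le_fisher_norm[OF vR] by (simp add: \<rho>_def)
  then show ?thesis using kappa_pos by (simp add: field_simps)
qed

lemma prob_mle_l1norm_le:
  fixes That :: "(nat \<Rightarrow> real) \<Rightarrow> nat \<Rightarrow> real"
  assumes N: "16 * leverage_bound * K * ln K \<le> real N" "1024 * leverage_bound * K < N"
    and mle: "\<And>X. X \<in> set_pmf (freq_pmf p N \<pi>) \<Longrightarrow> is_mle p K A X (That X)"
  shows "1 - 3 / K \<le> measure_pmf.prob (freq_pmf p N \<pi>)
    {X. l1norm {..<K} (\<lambda>k. That X k - T k) \<le> 32 * inverse \<kappa> * sqrt (K / N)}"
proof -
  obtain m f where m: "m \<le> K"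
    and orth: "\<And>a b. a < m \<Longrightarrow> b < m \<Longrightarrow> (\<Sum>j<p. \<pi> j * (f a j * f b j)) = of_bool (a = b)"
    and centred: "\<And>a. a < m \<Longrightarrow> (\<Sum>j<p. \<pi> j * f a j) = 0"
    and lev: "\<And>j. j < p \<Longrightarrow> (\<Sum>a<m. (f a j)\<^sup>2) \<le> leverage_bound"
    and span: "\<And>v. v \<in> contrasts \<Longrightarrow>
      \<exists>c. \<forall>j<p. 0 < \<pi> j \<longrightarrow> ratio v j = (\<Sum>a<m. c a * f a j)"
    by (rule orthonormal_ratios_exist; rule that; assumption)
  let ?P = "replicate_pmf N q"
  let ?X = "\<lambda>xs j. real (count_list xs j) / real N"
  let ?good = "{X. l1norm {..<K} (\<lambda>k. That X k - T k) \<le> 32 * inverse \<kappa> * sqrt (K / N)}"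
  define E1 where "E1 = {xs. 4 * K * N \<le> (L2_set (sample_sum (\<lambda>j a. f a j) xs) {..<m})\<^sup>2}"
  define E2 where "E2 = {xs. N / 2 \<le> L2_set (sample_sum (\<lambda>j (a, b). f a j * f b j - of_bool (a = b)) xs)
        ({..<m} \<times> {..<m})}"
  have B: "1 \<le> leverage_bound" by (rule leverage_bound_ge_1)
  have "leverage_bound * 1 \<le> leverage_bound * (1024 * K)"
    using B K by (intro mult_left_mono) auto
  then have BN: "leverage_bound \<le> N" using N(2) by (simp add: algebra_simps)
  then have N0: "0 < N" using B by (cases N) auto
  have freq: "freq_pmf p N \<pi> = map_pmf ?X ?P"
    by (simp add: freq_pmf_def multinomial_pmf_def map_pmf_comp)
  have "measure_pmf.prob ?P E1 \<le> 1 / K"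
    unfolding E1_def by (rule prob_linear_fluctuation_ge[OF m orth centred lev BN])
  moreover have "measure_pmf.prob ?P E2 \<le> 2 / K"
    unfolding E2_def by (rule prob_quadratic_fluctuation_ge[OF m orth lev N(1)])
  moreover have "measure_pmf.prob ?P (E1 \<union> E2) \<le> measure_pmf.prob ?P E1 + measure_pmf.prob ?P E2"
    by (rule measure_Un_le) auto
  ultimately have "1 - 3 / K \<le> 1 - measure_pmf.prob ?P (E1 \<union> E2)"
    by (simp add: add_divide_distrib[symmetric])
  also have "\<dots> = measure_pmf.prob ?P (- (E1 \<union> E2))"
    using measure_pmf.prob_compl[of "E1 \<union> E2" ?P] by (simp add: Compl_eq_Diff_UNIV)
  also have "\<dots> = measure_pmf.prob ?P (- (E1 \<union> E2) \<inter> set_pmf ?P)"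
    by (simp add: measure_Int_set_pmf)
  also have "\<dots> \<le> measure_pmf.prob ?P (?X -` ?good)"
  proof (rule measure_pmf.finite_measure_mono)
    show "- (E1 \<union> E2) \<inter> set_pmf ?P \<subseteq> ?X -` ?good"
    proof
      fix xs assume "xs \<in> - (E1 \<union> E2) \<inter> set_pmf ?P"
      then have xs: "xs \<in> set_pmf ?P" and E: "xs \<notin> E1" "xs \<notin> E2" by auto
      have "set xs \<subseteq> set_pmf q" "length xs = N"
        using xs by (auto simp: set_replicate_pmf)
      moreover have "is_mle p K A (?X xs) (That (?X xs))"
        using xs by (intro mle) (auto simp: freq)
      ultimately have "l1norm {..<K} (\<lambda>k. That (?X xs) k - T k) \<le> 32 * inverse \<kappa> * sqrt (K / N)"
        using E by (intro mle_l1norm_le[OF orth span _ _ N0 _ _ _ N(2)])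
          (auto simp: E1_def E2_def not_le less_imp_le)
      then show "xs \<in> ?X -` ?good" by simp
    qed
  qed auto
  also have "\<dots> = measure_pmf.prob (freq_pmf p N \<pi>) ?good"
    by (simp add: freq)
  finally show ?thesis .
qed

end

lemma J_lower_subset_J_upper:
  assumes "1 \<le> p" "\<And>j. 0 \<le> \<pi> j"
  shows "J_lower p N \<pi> \<subseteq> J_upper p \<pi>"
proof
  fix j assume j: "j \<in> J_lower p N \<pi>"
  have "0 \<le> eps p N \<pi> j"
    unfolding eps_def using assms by (intro add_nonneg_nonneg) simp_all
  then show "j \<in> J_upper p \<pi>" using j by (simp add: J_lower_def J_upper_def)
qed

theorem corollary3:
  shows "\<exists>C::real. C > 0 \<and> (\<exists>C1::real. C1 > 0 \<and>
    (\<forall>(p::nat) (K::nat) (N::nat) (A :: nat \<Rightarrow> nat \<Rightarrow> real) (Tstar :: nat \<Rightarrow> real)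
       (That :: (nat \<Rightarrow> real) \<Rightarrow> (nat \<Rightarrow> real)).
      let Pstar = mat_vec p K A Tstar;
          \<kappa>_lower = kappa K A (J_lower p N Pstar) K;
          \<kappa>_upper = kappa K A (J_upper p Pstar) K
      in
        1 \<le> K \<longrightarrow> K < p \<longrightarrow> 1 \<le> N \<longrightarrow>
        columns_in_simplex p K A \<longrightarrow>
        Tstar \<in> sparse_simplex K K \<longrightarrow>
        (\<forall>X \<in> set_pmf (freq_pmf p N Pstar). is_mle p K A X (That X)) \<longrightarrow>
        \<kappa>_lower > 0 \<longrightarrow>
        real N \<ge> C * (ln (real K) / (\<kappa>_lower ^ 4 * Tmin K Tstar ^ 3)) \<longrightarrow>
        measure_pmf.prob (freq_pmf p N Pstar)
          {X. l1norm {..<K} (\<lambda>k. That X k - Tstar k)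
                \<le> C1 * inverse \<kappa>_upper * sqrt (real K / real N)}
        \<ge> 1 - 2 * inverse (real p) - 4 * inverse (real K) - 2 * exp (- real K)))"
proof (rule exI[of _ "1025::real"], rule conjI, simp, rule exI[of _ "32::real"], rule conjI, simp,
    intro allI, goal_cases)
  case (1 p K N A T That)
  \<comment> \<open>The constant 1025 exceeds \<open>32\<^sup>2\<close>, as excluding \<open>\<rho> > \<kappa> \<tau>\<close> in \<open>mle_l1norm_le\<close> requires \<open>32 \<surd>(K / N) < \<kappa> \<tau>\<close>;
    it also exceeds the 16 that the exponential inequality needs.\<close>
  let ?\<pi> = "mat_vec p K A T"
  let ?kl = "kappa K A (J_lower p N ?\<pi>) K"
  let ?ku = "kappa K A (J_upper p ?\<pi>) K"
  let ?good = "{X. l1norm {..<K} (\<lambda>k. That X k - T k) \<le> 32 * inverse ?ku * sqrt (real K / real N)}"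
  have "1 - 2 * inverse (real p) - 4 * inverse (real K) - 2 * exp (- real K)
      \<le> measure_pmf.prob (freq_pmf p N ?\<pi>) ?good"
    if K: "1 \<le> K" and p: "K < p" and N: "1 \<le> N" and A: "columns_in_simplex p K A"
      and T: "T \<in> sparse_simplex K K"
      and mle: "\<forall>X \<in> set_pmf (freq_pmf p N ?\<pi>). is_mle p K A X (That X)"
      and kl: "0 < ?kl"
      and large: "1025 * (ln (real K) / (?kl ^ 4 * Tmin K T ^ 3)) \<le> real N"
  proof (cases "K \<le> 4")
    case True
    then have "1 \<le> 4 * inverse (real K)" using K by (simp add: field_simps)
    moreover have "0 \<le> measure_pmf.prob (freq_pmf p N ?\<pi>) ?good"
      "0 \<le> inverse (real p)" "0 \<le> exp (- real K)"
      by simp_all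
    ultimately show ?thesis by linarith
  next
    case False
    have "?kl \<le> ?ku"
    proof (intro kappa_mono J_lower_subset_J_upper)
      have "?\<pi> \<in> prob_simplex p"
        using A T by (intro mat_vec_in_prob_simplex) (auto simp: sparse_simplex_def)
      then show "0 \<le> ?\<pi> j" for j
        by (cases "j < p") (auto simp: prob_simplex_def Rvec_def)
    qed (use K p in \<open>auto simp: J_upper_def\<close>)
    with kl have ku: "0 < ?ku" by linarith
    interpret mixture p K A T
      by unfold_locales (use K A T ku in auto)
    have K0: "0 < real K" using K by simp
    \<comment> \<open>For \<open>K \<ge> 5\<close> the factor \<open>ln K\<close> in the assumption on \<open>N\<close> can be dropped.\<close>
    have "exp 1 \<le> real K" using exp_le False by linarith
    then have lnK: "1 \<le> ln (real K)" using K0 by (simp add: ln_ge_iff)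
    \<comment> \<open>One factor \<open>\<tau>\<close> supplies \<open>1 / K\<close>, and two factors of the condition number are given away.\<close>
    have "?kl ^ 4 * \<tau> ^ 3 \<le> (\<kappa> * \<tau>)\<^sup>2 / K"
    proof -
      have "?kl ^ 4 \<le> \<kappa> ^ 4" using \<open>?kl \<le> ?ku\<close> kl by (intro power_mono) auto
      also have "\<dots> \<le> \<kappa> ^ 2" using kappa_pos kappa_le_1 by (intro power_decreasing) auto
      finally have "?kl ^ 4 * \<tau> ^ 3 \<le> \<kappa>\<^sup>2 * \<tau> ^ 3"
        using Tmin_pos by (intro mult_right_mono) auto
      also have "\<dots> = (\<kappa> * \<tau>)\<^sup>2 * \<tau>" by (simp add: power2_eq_square power3_eq_cube)
      also have "\<dots> \<le> (\<kappa> * \<tau>)\<^sup>2 * (1 / K)"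
        using K_Tmin_le K0 by (intro mult_left_mono) (auto simp: field_simps)
      finally show ?thesis by simp
    qed
    then have "ln K / ((\<kappa> * \<tau>)\<^sup>2 / K) \<le> ln K / (?kl ^ 4 * \<tau> ^ 3)"
      using lnK kl Tmin_pos kappa_pos K0
      by (intro divide_left_mono mult_pos_pos divide_pos_pos zero_less_power) linarith+
    then have "leverage_bound * K * ln K \<le> ln K / (?kl ^ 4 * \<tau> ^ 3)"
      by (simp add: mult.commute)
    with large have main: "1025 * (leverage_bound * K * ln K) \<le> N" by linarith
    have BK: "1 \<le> leverage_bound * K"
      using mult_mono[OF leverage_bound_ge_1, of 1 "real K"] K by simp
    then have "leverage_bound * K * 1 \<le> leverage_bound * K * ln K"
      using lnK by (intro mult_left_mono) linarith+
    then have "1 - 3 / K \<le> measure_pmf.prob (freq_pmf p N ?\<pi>) ?good"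
      using main BK mle by (intro prob_mle_l1norm_le) auto
    moreover have "3 / K \<le> 4 * inverse (real K)" using K0 by (simp add: field_simps)
    moreover have "0 \<le> inverse (real p)" "0 \<le> exp (- real K)" by simp_all
    ultimately show ?thesis by linarith
  qed
  then show ?case by (simp add: Let_def)
qed

end
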